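(* The parameterized problem Stable Cutset[mod lin forest] is $\mathsf{MK[2]}$-hard under polynomial parameter transformations; i.e., every parameterized problem in $\mathsf{MK[2]}$ has a polynomial parameter transformation to Stable Cutset[mod lin forest].
   Context: All graphs are finite and simple. A stable cutset of a graph $G$ is a set $S\subseteq V(G)$ whose vertices are pairwise non-adjacent and such that $G-S$ is disconnected; the empty set is a stable cutset of any disconnected graph. A linear forest is a disjoint union of paths. Stable Cutset[mod lin forest]: input is a graph $G$ and $X\subseteq V(G)$ such that $G-X$ is a linear forest; parameter $|X|$; question: does $G$ have a stable cutset? A parameterized problem is a set $L\subseteq\Sigma^*\times\mathbb{N}$. A polynomial parameter transformation (PPT) from $Q$ to $Q'$ is a polynomial-time computable map $(x,k)\mapsto(x',k')$ with $(x,k)\in Q\iff(x',k')\in Q'$ and $k'$ bounded by a polynomial in $k$. Hitting Set[$n$]: input is a finite ground set $U$, a family $\mathcal{F}$ of subsets of $U$ and $k\in\mathbb{N}$; parameter $n=|U|$; question: is there $S\subseteq U$ with $|S|\le k$ and $S\cap F\neq\emptyset$ for all $F\in\mathcal{F}$? $\mathsf{MK[2]}$ is the class of all parameterized problems that have a PPT to Hitting Set[$n$]. *)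

theory Defs
  imports Main "HOL-Computational_Algebra.Polynomial"
begin

section \<open>Polynomial-time computability\<close>

text \<open>
  The machine model is a multi-stack machine with structured control. A program uses finitely many
  stacks and finitely many symbols, and one step inspects or changes only the tops of stacks.
  As a tape is a pair of stacks, and conversely a stack is a tape,
  such programs and multi-tape Turing machines simulate each other with linear overhead.
  Symbols and stack names are natural numbers; since symbols can only be compared with and
  produced from constants of the program, a program has no access to their numeric value.
\<close>

type_synonym symbol = nat
type_synonym stack = nat
type_synonym state = "stack \<Rightarrow> symbol list"

datatype test = Emp stack | Top stack symbol | Neg test | Conj test test

primrec holds :: "test \<Rightarrow> state \<Rightarrow> bool" where
  "holds (Emp r) s \<longleftrightarrow> s r = []"
| "holds (Top r a) s \<longleftrightarrow> s r \<noteq> [] \<and> hd (s r) = a"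
| "holds (Neg b) s \<longleftrightarrow> \<not> holds b s"
| "holds (Conj b b') s \<longleftrightarrow> holds b s \<and> holds b' s"

datatype program =
    Skip
  | Push stack symbol
  | Pop stack
  | Seq program program
  | Cond test program program
  | While test program

text \<open>\<open>exec c s t s'\<close>: started in state \<open>s\<close>, the program \<open>c\<close> halts in state \<open>s'\<close> after \<open>t\<close> steps.\<close>

inductive exec :: "program \<Rightarrow> state \<Rightarrow> nat \<Rightarrow> state \<Rightarrow> bool" where
  Skip: "exec Skip s 1 s"
| Push: "exec (Push r a) s 1 (s(r := a # s r))"
| Pop: "exec (Pop r) s 1 (s(r := tl (s r)))"
| Seq: "exec c s t s' \<Longrightarrow> exec d s' t' s'' \<Longrightarrow> exec (Seq c d) s (t + t') s''"
| CondTrue: "holds b s \<Longrightarrow> exec c s t s' \<Longrightarrow> exec (Cond b c d) s (Suc t) s'"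
| CondFalse: "\<not> holds b s \<Longrightarrow> exec d s t s' \<Longrightarrow> exec (Cond b c d) s (Suc t) s'"
| WhileFalse: "\<not> holds b s \<Longrightarrow> exec (While b c) s 1 s"
| WhileTrue: "holds b s \<Longrightarrow> exec c s t s' \<Longrightarrow> exec (While b c) s' t' s''
    \<Longrightarrow> exec (While b c) s (Suc (t + t')) s''"

lemma exec_deterministic:
  assumes "exec c s t s1" and "exec c s u s2"
  shows "t = u \<and> s1 = s2"
  using assms
proof (induction arbitrary: u s2 rule: exec.induct)
  case (WhileTrue b s c t s' t' s'')
  from WhileTrue.prems WhileTrue.hyps WhileTrue.IH show ?case
    by (cases rule: exec.cases) blast+
qed (erule exec.cases; blast)+

text \<open>
  An element \<open>(x, k)\<close> of \<open>\<Sigma>\<^sup>* \<times> \<nat>\<close> is presented with \<open>x\<close> on stack 0 and \<open>k\<close> in unary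
  on stack 1, following the convention that running times are measured in \<open>\<bar>x\<bar> + k\<close>.
  Results are returned in the same way; the final content of the other stacks is irrelevant.
\<close>

definition initial_state :: "symbol list \<Rightarrow> nat \<Rightarrow> state" where
  "initial_state x k = (\<lambda>_. [])(0 := x, 1 := replicate k 0)"

definition poly_time_computable ::
    "symbol set \<Rightarrow> (symbol list \<times> nat \<Rightarrow> symbol list \<times> nat) \<Rightarrow> bool" where
  "poly_time_computable \<Sigma> f \<longleftrightarrow>
    (\<exists>(c :: program) (p :: nat poly). \<forall>x \<in> lists \<Sigma>. \<forall>k. \<exists>t s.
       exec c (initial_state x k) t s \<and> t \<le> poly p (length x + k) \<and>
       s 0 = fst (f (x, k)) \<and> s 1 = replicate (snd (f (x, k))) 0)"


section \<open>Parameterized problems and polynomial parameter transformations\<close>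

text \<open>A parameterized problem is given together with its alphabet.\<close>

type_synonym param_problem = "symbol set \<times> (symbol list \<times> nat) set"

definition parameterized_problem :: "param_problem \<Rightarrow> bool" where
  "parameterized_problem = (\<lambda>(\<Sigma>, L). finite \<Sigma> \<and> L \<subseteq> lists \<Sigma> \<times> UNIV)"

definition has_ppt :: "param_problem \<Rightarrow> param_problem \<Rightarrow> bool" (infix "\<le>\<^sub>p\<^sub>p\<^sub>t" 50) where
  "has_ppt = (\<lambda>(\<Sigma>, L) (\<Sigma>', L').
    \<exists>f. poly_time_computable \<Sigma> f \<and>
      (\<forall>x \<in> lists \<Sigma>. \<forall>k. fst (f (x, k)) \<in> lists \<Sigma>') \<and>
      (\<forall>x \<in> lists \<Sigma>. \<forall>k. (x, k) \<in> L \<longleftrightarrow> f (x, k) \<in> L') \<and>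
      (\<exists>q :: nat poly. \<forall>x \<in> lists \<Sigma>. \<forall>k. snd (f (x, k)) \<le> poly q k))"

definition ppt_hard :: "param_problem set \<Rightarrow> param_problem \<Rightarrow> bool" where
  "ppt_hard C Q \<longleftrightarrow> parameterized_problem Q \<and> (\<forall>P \<in> C. P \<le>\<^sub>p\<^sub>p\<^sub>t Q)"


section \<open>Graphs and stable cutsets\<close>

type_synonym 'v graph = "'v set \<times> 'v set set"

definition simple_graph :: "'v graph \<Rightarrow> bool" where
  "simple_graph = (\<lambda>(V, E). finite V \<and> (\<forall>e \<in> E. \<exists>u \<in> V. \<exists>v \<in> V. u \<noteq> v \<and> e = {u, v}))"

definition delete_vertices :: "'v graph \<Rightarrow> 'v set \<Rightarrow> 'v graph" where
  "delete_vertices = (\<lambda>(V, E) S. (V - S, {e \<in> E. e \<inter> S = {}}))"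

text \<open>In particular the graph without vertices is not disconnected.\<close>

definition disconnected :: "'v graph \<Rightarrow> bool" where
  "disconnected = (\<lambda>(V, E). \<exists>u \<in> V. \<exists>v \<in> V. (u, v) \<notin> {(a, b). {a, b} \<in> E}\<^sup>*)"

definition stable_cutset :: "'v graph \<Rightarrow> 'v set \<Rightarrow> bool" where
  "stable_cutset G S \<longleftrightarrow> S \<subseteq> fst G \<and> (\<forall>u \<in> S. \<forall>v \<in> S. {u, v} \<notin> snd G) \<and>
     disconnected (delete_vertices G S)"

text \<open>The edges of the path that visits the vertices of a list in this order\<close>

definition path_edges :: "'v list \<Rightarrow> 'v set set" where
  "path_edges p = {{p ! i, p ! Suc i} | i. Suc i < length p}"

definition linear_forest :: "'v graph \<Rightarrow> bool" where
  "linear_forest = (\<lambda>(V, E). \<exists>ps. [] \<notin> set ps \<and> distinct (concat ps) \<and>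
     V = set (concat ps) \<and> E = (\<Union>p \<in> set ps. path_edges p))"


section \<open>The two problems\<close>

text \<open>
  Instances live on the ground set or vertex set \<open>{..<n}\<close> and are written over the alphabet
  \<open>{0, 1, 2}\<close>: 0 is a tally mark, 1 ends a number, 2 ends a list of numbers.
  Elements are listed explicitly, so that unary notation costs only a polynomial factor for them.
  This is also harmless for the budget \<open>k\<close> of Hitting Set, which can be capped at \<open>n\<close>.
\<close>

definition encode_nat :: "nat \<Rightarrow> symbol list" where
  "encode_nat n = replicate n 0 @ [1]"

definition encode_nats :: "nat list \<Rightarrow> symbol list" where
  "encode_nats ns = concat (map encode_nat ns) @ [2]"

definition encode_hitting_set :: "nat \<Rightarrow> nat list list \<Rightarrow> nat \<Rightarrow> symbol list" where
  "encode_hitting_set n Fs k = encode_nat n @ encode_nat k @ concat (map encode_nats Fs)"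

definition encode_graph :: "nat \<Rightarrow> (nat \<times> nat) list \<Rightarrow> nat list \<Rightarrow> symbol list" where
  "encode_graph n es xs =
     encode_nat n @ encode_nats (concat (map (\<lambda>(u, v). [u, v]) es)) @ encode_nats xs"

lemma encode_nat_append_inject:
  "encode_nat m @ xs = encode_nat n @ ys \<longleftrightarrow> m = n \<and> xs = ys"
proof (induction m arbitrary: n)
  case 0
  show ?case by (cases n) (auto simp: encode_nat_def)
next
  case (Suc m)
  then show ?case by (cases n) (auto simp: encode_nat_def)
qed

lemma encode_nat_not_2: "encode_nat m @ xs \<noteq> 2 # ys"
  by (cases m) (auto simp: encode_nat_def)

lemma encode_nats_append_inject:
  "encode_nats ms @ xs = encode_nats ns @ ys \<longleftrightarrow> ms = ns \<and> xs = ys"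
proof (induction ms arbitrary: ns)
  case Nil
  show ?case
    by (cases ns) (auto simp: encode_nats_def encode_nat_not_2[THEN not_sym])
next
  case (Cons m ms)
  show ?case
  proof (cases ns)
    case Nil
    then show ?thesis by (auto simp: encode_nats_def encode_nat_not_2)
  next
    case (Cons n ns')
    then show ?thesis
      using Cons.IH[of ns'] by (auto simp: encode_nats_def encode_nat_append_inject)
  qed
qed

lemma encode_hitting_set_inject:
  "encode_hitting_set n Fs k = encode_hitting_set n' Fs' k' \<longleftrightarrow> n = n' \<and> Fs = Fs' \<and> k = k'"
proof -
  have "Fs = Fs'" if "concat (map encode_nats Fs) = concat (map encode_nats Fs')"
    using that
  proof (induction Fs arbitrary: Fs')
    case Nil
    then show ?case by (cases Fs') (auto simp: encode_nats_def)
  next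
    case (Cons F Fs)
    then show ?case
      by (cases Fs') (auto simp: encode_nats_append_inject, simp add: encode_nats_def)
  qed
  then show ?thesis
    by (auto simp: encode_hitting_set_def encode_nat_append_inject)
qed

lemma encode_graph_inject:
  "encode_graph n es xs = encode_graph n' es' xs' \<longleftrightarrow> n = n' \<and> es = es' \<and> xs = xs'"
proof -
  have "es = es'"
    if "concat (map (\<lambda>(u, v). [u, v]) es) = concat (map (\<lambda>(u, v). [u, v]) es')"
    using that
  proof (induction es arbitrary: es')
    case Nil
    then show ?case by (cases es') auto
  next
    case (Cons e es)
    then show ?case by (cases e; cases es') auto
  qed
  then show ?thesis
    using encode_nats_append_inject[of xs "[]" xs' "[]"]
    by (auto simp: encode_graph_def encode_nat_append_inject encode_nats_append_inject)
qed

definition hitting_set :: "'a set \<Rightarrow> 'a set set \<Rightarrow> 'a set \<Rightarrow> bool" where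
  "hitting_set U F S \<longleftrightarrow> S \<subseteq> U \<and> (\<forall>A \<in> F. S \<inter> A \<noteq> {})"

definition HittingSet_n :: param_problem where
  "HittingSet_n = ({0, 1, 2},
     {(encode_hitting_set n Fs k, n) | n Fs k.
        (\<forall>F \<in> set Fs. set F \<subseteq> {..<n}) \<and>
        (\<exists>S. hitting_set {..<n} (set ` set Fs) S \<and> card S \<le> k)})"

definition graph_of :: "nat \<Rightarrow> (nat \<times> nat) list \<Rightarrow> nat graph" where
  "graph_of n es = ({..<n}, {{u, v} | u v. (u, v) \<in> set es})"

definition StableCutset_mod_lin_forest :: param_problem where
  "StableCutset_mod_lin_forest = ({0, 1, 2},
     {(encode_graph n es xs, card (set xs)) | n es xs.
        simple_graph (graph_of n es) \<and> set xs \<subseteq> {..<n} \<and>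
        linear_forest (delete_vertices (graph_of n es) (set xs)) \<and>
        (\<exists>S. stable_cutset (graph_of n es) S)})"

definition MK2 :: "param_problem set" where
  "MK2 = {Q. parameterized_problem Q \<and> Q \<le>\<^sub>p\<^sub>p\<^sub>t HittingSet_n}"

end

theory Submission
  imports Defs
begin

text \<open>
  A stable cutset is a labelling of the vertices by two sides and a cutset such that the ends of an edge
  are neither both in the cutset nor on different sides, and both sides occur. For a Hitting Set instance with
  \<open>n\<close> elements and budget \<open>k\<close>, the modulator has \<open>O(n\<^sup>2)\<close> vertices; a labelling of it amounts to a choice of at
  most one element for each of \<open>min n k\<close> slots. Every set of the family becomes one path in the rest of
  the graph. Its first vertex is forced to one side and its last to the other, and the path can change sides
  only at a vertex that the modulator allows to be in the cutset, which happens iff one of the elements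
  of the set was chosen.
\<close>

section \<open>Composition of polynomial-time computable functions\<close>

text \<open>The family may be far larger than any polynomial in \<open>n\<close>, so the sets have
  to be handled outside the modulator; a path is a disjunction of unbounded length whose vertices
  only consult the modulator. The budget is turned into adjacency: the vertices that put some
  element into one given slot are pairwise adjacent, so a stable set contains at most one of them.
  With a pair of vertices per element and slot this costs \<open>2 * n * n\<close> vertices. The
  main obstacle is that a stable cutset may separate any two vertices, not only the intended ones.
  Triangles answer it: a stable set meets a triangle at most once, and the remaining vertices of it
  lie on one side. The terminals 0 and 2 get adjacent twins 1 and 3, so that one vertex of each twin
  pair stays outside the cutset, and vertex 4 ties terminals and paths together unless it is cut
  itself. The second obstacle is that computability refers to a concrete machine. The graph is
  therefore emitted by nested counting loops with a single pass over the input, and running times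
  are bounded by induction on the program.\<close>

lemma poly_nat_mono: "a \<le> b \<Longrightarrow> poly p a \<le> poly (p :: nat poly) b"
  by (induction p) (auto intro: add_mono mult_mono)

section \<open>Frame and length properties of executions\<close>

primrec stacks :: "program \<Rightarrow> stack set" where
  "stacks Skip = {}"
| "stacks (Push r a) = {r}"
| "stacks (Pop r) = {r}"
| "stacks (Seq c d) = stacks c \<union> stacks d"
| "stacks (Cond b c d) = stacks c \<union> stacks d"
| "stacks (While b c) = stacks c"

lemma finite_stacks: "finite (stacks c)"
  by (induction c) auto

lemma exec_frame: "exec c s t s' \<Longrightarrow> r \<notin> stacks c \<Longrightarrow> s' r = s r"
  by (induction rule: exec.induct) auto

text \<open>A step pushes at most one symbol. Running time therefore bounds the size of an
  intermediate result, on which the second program of a composition runs.\<close>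

lemma exec_length_le: "exec c s t s' \<Longrightarrow> length (s' r) \<le> length (s r) + t"
  by (induction rule: exec.induct) auto

definition clear :: "stack \<Rightarrow> program" where
  "clear r = While (Neg (Emp r)) (Pop r)"

lemma exec_clear: "exec (clear r) s (2 * length (s r) + 1) (s(r := []))"
proof (induction "length (s r)" arbitrary: s)
  case 0
  then have "s(r := []) = s" by auto
  then show ?case
    using 0 WhileFalse[of "Neg (Emp r)" s "Pop r"] by (simp add: clear_def)
next
  case (Suc n)
  let ?s = "s(r := tl (s r))"
  have "exec (clear r) ?s (2 * length (?s r) + 1) (?s(r := []))"
    using Suc.hyps(2) by (intro Suc.hyps(1)) simp
  then have "exec (clear r) s (Suc (1 + (2 * length (?s r) + 1))) (?s(r := []))"
    unfolding clear_def using Suc.hyps(2) by (intro WhileTrue[OF _ Pop]) auto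
  moreover have "Suc (1 + (2 * length (?s r) + 1)) = 2 * length (s r) + 1"
    using Suc.hyps(2) by (cases "s r") auto
  ultimately show ?case by simp
qed

primrec clear_all :: "stack list \<Rightarrow> program" where
  "clear_all [] = Skip"
| "clear_all (r # rs) = Seq (clear r) (clear_all rs)"

lemma exec_clear_all:
  assumes "\<And>r. length (s r) \<le> M"
  shows "\<exists>t. exec (clear_all rs) s t (\<lambda>r. if r \<in> set rs then [] else s r)
    \<and> t \<le> length rs * (2 * M + 1) + 1"
  using assms
proof (induction rs arbitrary: s)
  case Nil
  show ?case using exec.Skip[of s] by auto
next
  case (Cons r rs)
  let ?s = "s(r := [])"
  have "length (?s q) \<le> M" for q using Cons.prems by simp
  from Cons.IH[of ?s, OF this] obtain t where
    t: "exec (clear_all rs) ?s t (\<lambda>q. if q \<in> set rs then [] else ?s q)"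
       "t \<le> length rs * (2 * M + 1) + 1"
    by blast
  have eq: "(\<lambda>q. if q \<in> set rs then [] else ?s q) = (\<lambda>q. if q \<in> set (r # rs) then [] else s q)"
    by auto
  have "exec (clear_all (r # rs)) s (2 * length (s r) + 1 + t)
      (\<lambda>q. if q \<in> set (r # rs) then [] else s q)"
    unfolding clear_all.simps by (rule exec.Seq[OF exec_clear t(1)[unfolded eq]])
  moreover have "2 * length (s r) + 1 + t \<le> length (r # rs) * (2 * M + 1) + 1"
    using t(2) Cons.prems[of r] by simp
  ultimately show ?case by blast
qed

text \<open>\<open>poly_time_computable\<close> tolerates leftovers on auxiliary stacks, whereas a
  following program expects these to be empty. Only the finitely many stacks named in the program
  can be affected, so a fixed list of clearing loops restores an initial state.\<close>

lemma poly_time_computable_clean: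
  assumes "poly_time_computable \<Sigma> f"
  obtains c p where "\<And>x k. x \<in> lists \<Sigma> \<Longrightarrow> \<exists>t.
    exec c (initial_state x k) t (initial_state (fst (f (x, k))) (snd (f (x, k)))) \<and>
    t \<le> poly p (length x + k)"
proof -
  from assms obtain c p where c: "\<And>x k. x \<in> lists \<Sigma> \<Longrightarrow> \<exists>t s.
       exec c (initial_state x k) t s \<and> t \<le> poly p (length x + k) \<and>
       s 0 = fst (f (x, k)) \<and> s 1 = replicate (snd (f (x, k))) 0"
    unfolding poly_time_computable_def by blast
  obtain rs where rs: "set rs = stacks c - {0, 1}"
    using finite_list[of "stacks c - {0, 1}"] finite_stacks by blast
  \<comment> \<open>On input size \<open>n\<close> every stack holds at most \<open>n + p(n)\<close>
    symbols after the run, and clearing it costs twice that plus one.\<close>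
  define q where "q = p + [:length rs:] * ([:1:] + [:2:] * ([:0, 1:] + p)) + [:1:]"
  show ?thesis
  proof (rule that[of "Seq c (clear_all rs)" q])
    fix x k assume x: "x \<in> lists \<Sigma>"
    let ?n = "length x + k"
    from c[OF x, of k] obtain t s where
      e: "exec c (initial_state x k) t s" and t: "t \<le> poly p ?n" and
      s: "s 0 = fst (f (x, k))" "s 1 = replicate (snd (f (x, k))) 0"
      by blast
    have "length (s r) \<le> ?n + poly p ?n" for r
    proof -
      have "length (initial_state x k r) \<le> ?n"
        by (simp add: initial_state_def)
      then show ?thesis using exec_length_le[OF e, of r] t by linarith
    qed
    from exec_clear_all[of s, OF this, of rs] obtain u where
      u: "exec (clear_all rs) s u (\<lambda>r. if r \<in> set rs then [] else s r)"
         "u \<le> length rs * (2 * (?n + poly p ?n) + 1) + 1"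
      by blast
    have "(\<lambda>r. if r \<in> set rs then [] else s r)
        = initial_state (fst (f (x, k))) (snd (f (x, k)))"
    proof
      fix r
      show "(if r \<in> set rs then [] else s r) = initial_state (fst (f (x, k))) (snd (f (x, k))) r"
        using exec_frame[OF e, of r] rs s by (auto simp: initial_state_def)
    qed
    with exec.Seq[OF e u(1)]
    have "exec (Seq c (clear_all rs)) (initial_state x k) (t + u)
        (initial_state (fst (f (x, k))) (snd (f (x, k))))"
      by simp
    moreover have "t + u \<le> poly q ?n"
      using t u(2) by (simp add: q_def algebra_simps)
    ultimately show "\<exists>t. exec (Seq c (clear_all rs)) (initial_state x k) t
        (initial_state (fst (f (x, k))) (snd (f (x, k)))) \<and> t \<le> poly q ?n"
      by blast
  qed
qed

lemma poly_time_computable_comp: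
  assumes f: "poly_time_computable \<Sigma> f" and g: "poly_time_computable \<Sigma>' g"
    and maps: "\<And>x k. x \<in> lists \<Sigma> \<Longrightarrow> fst (f (x, k)) \<in> lists \<Sigma>'"
  shows "poly_time_computable \<Sigma> (g \<circ> f)"
proof -
  obtain c p where c: "\<And>x k. x \<in> lists \<Sigma> \<Longrightarrow> \<exists>t.
      exec c (initial_state x k) t (initial_state (fst (f (x, k))) (snd (f (x, k)))) \<and>
      t \<le> poly p (length x + k)"
    using poly_time_computable_clean[OF f] by blast
  obtain d q where d: "\<And>x k. x \<in> lists \<Sigma>' \<Longrightarrow> \<exists>t s.
       exec d (initial_state x k) t s \<and> t \<le> poly q (length x + k) \<and>
       s 0 = fst (g (x, k)) \<and> s 1 = replicate (snd (g (x, k))) 0"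
    using g unfolding poly_time_computable_def by blast
  \<comment> \<open>Word and parameter each grow by at most the running time, so the intermediate
    instance has size at most \<open>2 * (n + p(n))\<close>.\<close>
  define P where "P = p + pcompose q ([:2:] * ([:0, 1:] + p))"
  have "\<exists>t s. exec (Seq c d) (initial_state x k) t s \<and> t \<le> poly P (length x + k) \<and>
       s 0 = fst ((g \<circ> f) (x, k)) \<and> s 1 = replicate (snd ((g \<circ> f) (x, k))) 0"
    if x: "x \<in> lists \<Sigma>" for x k
  proof -
    let ?n = "length x + k"
    obtain y l where fy: "f (x, k) = (y, l)" by (cases "f (x, k)")
    from c[OF x, of k] obtain t where
      e: "exec c (initial_state x k) t (initial_state y l)" and t: "t \<le> poly p ?n"
      by (auto simp: fy)
    have "y \<in> lists \<Sigma>'" using maps[OF x, of k] by (simp add: fy)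
    from d[OF this, of l] obtain u s where
      u: "exec d (initial_state y l) u s" "u \<le> poly q (length y + l)"
         "s 0 = fst (g (y, l))" "s 1 = replicate (snd (g (y, l))) 0"
      by blast
    have "length y \<le> length x + t" "l \<le> k + t"
      using exec_length_le[OF e, of 0] exec_length_le[OF e, of 1]
      by (auto simp: initial_state_def)
    with t have "length y + l \<le> 2 * (?n + poly p ?n)"
      by (simp add: distrib_left)
    then have "poly q (length y + l) \<le> poly q (2 * (?n + poly p ?n))" by (rule poly_nat_mono)
    then have "t + u \<le> poly P ?n"
      using t u(2) by (simp add: P_def poly_pcompose algebra_simps)
    with exec.Seq[OF e u(1)] u(3,4) show ?thesis by (auto simp: fy)
  qed
  then show ?thesis unfolding poly_time_computable_def by blast
qed

text \<open>Membership in \<open>MK2\<close> already supplies a transformation to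
  \<open>HittingSet_n\<close>; by transitivity, a single one from there to the target
  suffices.\<close>

lemma has_ppt_trans:
  assumes "P \<le>\<^sub>p\<^sub>p\<^sub>t Q" and "Q \<le>\<^sub>p\<^sub>p\<^sub>t R"
  shows "P \<le>\<^sub>p\<^sub>p\<^sub>t R"
proof -
  obtain \<Sigma> L \<Sigma>' L' \<Sigma>'' L'' where PQR: "P = (\<Sigma>, L)" "Q = (\<Sigma>', L')" "R = (\<Sigma>'', L'')"
    by (cases P, cases Q, cases R)
  from assms(1)[unfolded PQR has_ppt_def] obtain f q where
    f: "poly_time_computable \<Sigma> f" "\<And>x k. x \<in> lists \<Sigma> \<Longrightarrow> fst (f (x, k)) \<in> lists \<Sigma>'"
       "\<And>x k. x \<in> lists \<Sigma> \<Longrightarrow> (x, k) \<in> L \<longleftrightarrow> f (x, k) \<in> L'"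
       "\<And>x k. x \<in> lists \<Sigma> \<Longrightarrow> snd (f (x, k)) \<le> poly q k"
    by (clarsimp) blast
  from assms(2)[unfolded PQR has_ppt_def] obtain g q' where
    g: "poly_time_computable \<Sigma>' g" "\<And>x k. x \<in> lists \<Sigma>' \<Longrightarrow> fst (g (x, k)) \<in> lists \<Sigma>''"
       "\<And>x k. x \<in> lists \<Sigma>' \<Longrightarrow> (x, k) \<in> L' \<longleftrightarrow> g (x, k) \<in> L''"
       "\<And>x k. x \<in> lists \<Sigma>' \<Longrightarrow> snd (g (x, k)) \<le> poly q' k"
    by (clarsimp) blast
  have g': "fst (g (f (x, k))) \<in> lists \<Sigma>''" "(x, k) \<in> L \<longleftrightarrow> g (f (x, k)) \<in> L''"
      "snd (g (f (x, k))) \<le> poly (pcompose q' q) k"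
    if "x \<in> lists \<Sigma>" for x k
  proof -
    obtain y l where y: "f (x, k) = (y, l)" by (cases "f (x, k)")
    note fy = f(2-4)[OF that, of k, unfolded y fst_conv snd_conv]
    show "fst (g (f (x, k))) \<in> lists \<Sigma>''" "(x, k) \<in> L \<longleftrightarrow> g (f (x, k)) \<in> L''"
      using fy g(2,3) by (simp_all add: y)
    show "snd (g (f (x, k))) \<le> poly (pcompose q' q) k"
      using order.trans[OF g(4)[OF fy(1), of l] poly_nat_mono[OF fy(3)]]
      by (simp add: y poly_pcompose)
  qed
  have "poly_time_computable \<Sigma> (g \<circ> f)"
    by (rule poly_time_computable_comp[OF f(1) g(1) f(2)])
  with g' show ?thesis
    unfolding PQR has_ppt_def split
    by (intro exI[of _ "g \<circ> f"] conjI exI[of _ "pcompose q' q"]) simp_all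
qed

section \<open>A small language compiled to stack programs\<close>

definition loop :: "stack \<Rightarrow> program \<Rightarrow> program" where
  "loop r c = While (Neg (Emp r)) (Seq (Pop r) c)"

text \<open>\<open>S i\<close> is the state in which \<open>i\<close> rounds remain. The counter is
  popped before the body runs, so the body sees the values \<open>m - 1\<close> down to 0.\<close>

lemma exec_loop:
  assumes len: "\<And>i. i \<le> m \<Longrightarrow> length (S i r) = i"
    and body: "\<And>i. i < m \<Longrightarrow> \<exists>t. exec c ((S (Suc i))(r := tl (S (Suc i) r))) t (S i) \<and> t \<le> T"
  shows "\<exists>t. exec (loop r c) (S m) t (S 0) \<and> t \<le> m * (T + 2) + 1"
  using assms
proof (induction m)
  case 0
  then show ?case
    using WhileFalse[of "Neg (Emp r)" "S 0" "Seq (Pop r) c"] by (auto simp: loop_def)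
next
  case (Suc m)
  obtain t where t: "exec (loop r c) (S m) t (S 0)" "t \<le> m * (T + 2) + 1"
    using Suc.IH Suc.prems by (meson le_SucI less_SucI)
  obtain u where u: "exec c ((S (Suc m))(r := tl (S (Suc m) r))) u (S m)" "u \<le> T"
    using Suc.prems(2)[of m] by blast
  have "holds (Neg (Emp r)) (S (Suc m))" using Suc.prems(1)[of "Suc m"] by auto
  from WhileTrue[OF this exec.Seq[OF exec.Pop u(1)] t(1)[unfolded loop_def]]
  show ?case
    using t(2) u(2) by (auto simp: loop_def intro!: exI[of _ "Suc (1 + u + t)"])
qed

text \<open>Stack 3 is reserved as the buffer of this copying routine.\<close>

definition add :: "stack \<Rightarrow> stack \<Rightarrow> program" where
  "add r d = Seq (loop r (Push 3 0)) (loop 3 (Seq (Push r 0) (Push d 0)))"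

lemma replicate_diff_Suc: "i < m \<Longrightarrow> a # replicate (m - Suc i) a = replicate (m - i) a"
  by (metis Suc_diff_Suc replicate_Suc)

lemma exec_add:
  assumes "s r = replicate m 0" "s 3 = []" "r \<noteq> 3" "d \<noteq> 3" "r \<noteq> d"
  shows "\<exists>t. exec (add r d) s t (s(d := replicate m 0 @ s d)) \<and> t \<le> 7 * m + 2"
proof -
  \<comment> \<open>Reading a unary stack destroys it, hence two loops: \<open>S\<close> describes
    moving \<open>r\<close> to the buffer, \<open>S'\<close> restoring it while copying to
    \<open>d\<close>.\<close>
  define S where "S = (\<lambda>i. s(r := replicate i 0, 3 := replicate (m - i) 0))"
  define S' where "S' = (\<lambda>i. s(r := replicate (m - i) 0, 3 := replicate i 0,
    d := replicate (m - i) 0 @ s d))"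
  have "\<exists>t. exec (Push 3 0) ((S (Suc i))(r := tl (S (Suc i) r))) t (S i) \<and> t \<le> 1"
    if "i < m" for i
  proof -
    let ?s = "(S (Suc i))(r := tl (S (Suc i) r))"
    have "?s(3 := 0 # ?s 3) = S i"
      using that assms by (auto simp: S_def fun_eq_iff replicate_diff_Suc)
    then show ?thesis using exec.Push[of 3 0 ?s] by auto
  qed
  moreover have "length (S i r) = i" if "i \<le> m" for i
    using assms by (simp add: S_def)
  ultimately obtain t where t: "exec (loop r (Push 3 0)) (S m) t (S 0)" "t \<le> m * (1 + 2) + 1"
    using exec_loop[of m S r "Push 3 0" 1] by blast
  have "\<exists>t. exec (Seq (Push r 0) (Push d 0)) ((S' (Suc i))(3 := tl (S' (Suc i) 3))) t (S' i) \<and> t \<le> 2"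
    if "i < m" for i
  proof -
    let ?s = "(S' (Suc i))(3 := tl (S' (Suc i) 3))"
    let ?s' = "?s(r := 0 # ?s r)"
    have "?s'(d := 0 # ?s' d) = S' i"
      using that assms by (auto simp: S'_def fun_eq_iff replicate_diff_Suc simp flip: append_Cons)
    then show ?thesis
      using exec.Seq[OF exec.Push[of r 0 ?s] exec.Push[of d 0 ?s']] by auto
  qed
  moreover have "length (S' i 3) = i" if "i \<le> m" for i
    using assms by (simp add: S'_def)
  ultimately obtain u where u: "exec (loop 3 (Seq (Push r 0) (Push d 0))) (S' m) u (S' 0)"
      "u \<le> m * (2 + 2) + 1"
    using exec_loop[of m S' 3 "Seq (Push r 0) (Push d 0)" 2] by blast
  have "S m = s" "S 0 = S' m" "S' 0 = s(d := replicate m 0 @ s d)"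
    using assms by (auto simp: S_def S'_def fun_eq_iff)
  then have "exec (add r d) s (t + u) (s(d := replicate m 0 @ s d))"
    using exec.Seq[OF t(1)] u(1) unfolding add_def by metis
  then show ?thesis using t(2) u(2) by (intro exI[of _ "t + u"]) simp
qed

section \<open>Arithmetic expressions over unary registers\<close>

datatype expr = Const nat | Var stack | Plus expr expr | Times expr expr

primrec val :: "expr \<Rightarrow> (stack \<Rightarrow> nat) \<Rightarrow> nat" where
  "val (Const m) \<rho> = m"
| "val (Var r) \<rho> = \<rho> r"
| "val (Plus a b) \<rho> = val a \<rho> + val b \<rho>"
| "val (Times a b) \<rho> = val a \<rho> * val b \<rho>"

primrec vars :: "expr \<Rightarrow> stack set" where
  "vars (Const m) = {}"
| "vars (Var r) = {r}"
| "vars (Plus a b) = vars a \<union> vars b"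
| "vars (Times a b) = vars a \<union> vars b"

lemma val_cong: "(\<And>r. r \<in> vars e \<Longrightarrow> \<rho> r = \<rho>' r) \<Longrightarrow> val e \<rho> = val e \<rho>'"
  by (induction e) auto

text \<open>Expressions are polynomials in the registers with natural coefficients, so they are
  monotone and one polynomial in a common bound \<open>B\<close> suffices. All running times below
  refer to such a \<open>B\<close>.\<close>

lemma val_bound: "\<exists>p :: nat poly. \<forall>\<rho> B. (\<forall>r. \<rho> r \<le> B) \<longrightarrow> val e \<rho> \<le> poly p B"
proof (induction e)
  case (Const m)
  show ?case by (rule exI[of _ "[:m:]"]) simp
next
  case (Var r)
  show ?case by (rule exI[of _ "[:0, 1:]"]) simp
next
  case (Plus a b)
  then obtain p q where "\<forall>\<rho> B. (\<forall>r. \<rho> r \<le> B) \<longrightarrow> val a \<rho> \<le> poly p B"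
      "\<forall>\<rho> B. (\<forall>r. \<rho> r \<le> B) \<longrightarrow> val b \<rho> \<le> poly q B"
    by blast
  then show ?case by (intro exI[of _ "p + q"]) (simp add: add_mono)
next
  case (Times a b)
  then obtain p q where "\<forall>\<rho> B. (\<forall>r. \<rho> r \<le> B) \<longrightarrow> val a \<rho> \<le> poly p B"
      "\<forall>\<rho> B. (\<forall>r. \<rho> r \<le> B) \<longrightarrow> val b \<rho> \<le> poly q B"
    by blast
  then show ?case by (intro exI[of _ "p * q"]) (simp add: mult_mono)
qed

text \<open>
  Registers are the stacks other than 0 (input), 2 (output) and 3 (buffer); they hold numbers in unary.
  \<open>compile_expr e d k\<close> adds the value of \<open>e\<close> to stack \<open>d\<close> and uses
  the stacks from \<open>k\<close> on as temporaries.
\<close>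

abbreviation register :: "stack \<Rightarrow> bool" where
  "register r \<equiv> r \<notin> {0, 2, 3}"

definition rep :: "state \<Rightarrow> (stack \<Rightarrow> nat) \<Rightarrow> bool" where
  "rep s \<rho> \<longleftrightarrow> s 3 = [] \<and> (\<forall>r. register r \<longrightarrow> s r = replicate (\<rho> r) 0)"

primrec compile_expr :: "expr \<Rightarrow> stack \<Rightarrow> stack \<Rightarrow> program" where
  "compile_expr (Const m) d k = ((Seq (Push d 0)) ^^ m) Skip"
| "compile_expr (Var r) d k = add r d"
| "compile_expr (Plus a b) d k = Seq (compile_expr a d k) (compile_expr b d k)"
| "compile_expr (Times a b) d k =
    Seq (compile_expr a k (Suc k)) (loop k (compile_expr b d (Suc k)))"

lemma exec_pushes: "exec (((Seq (Push d 0)) ^^ m) Skip) s (m + 1) (s(d := replicate m 0 @ s d))"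
proof (induction m arbitrary: s)
  case 0
  show ?case using exec.Skip[of s] by simp
next
  case (Suc m)
  let ?s = "s(d := 0 # s d)"
  have "?s(d := replicate m 0 @ ?s d) = s(d := replicate (Suc m) 0 @ s d)"
    by (simp add: replicate_app_Cons_same)
  moreover have "exec (Seq (Push d 0) (((Seq (Push d 0)) ^^ m) Skip)) s (1 + (m + 1))
      (?s(d := replicate m 0 @ ?s d))"
    by (rule exec.Seq[OF exec.Push Suc.IH])
  ultimately show ?case by (simp del: fun_upd_apply)
qed

text \<open>The target may also be stack 0 or 2. There \<open>rep\<close> ignores the entry of the
  valuation, so that one statement covers registers, input and output.\<close>

lemma rep_upd: "rep s \<rho> \<Longrightarrow> d \<noteq> 3 \<Longrightarrow>
    rep (s(d := replicate m 0 @ s d)) (\<rho>(d := m + \<rho> d))"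
  by (auto simp: rep_def replicate_add)

text \<open>The polynomial is fixed before state and target. The condition
  \<open>d \<notin> vars e\<close> matters because \<open>d\<close> has already changed when later
  subexpressions are evaluated.\<close>

definition expr_time :: "expr \<Rightarrow> stack \<Rightarrow> nat poly \<Rightarrow> bool" where
  "expr_time e k p \<longleftrightarrow> (\<forall>s \<rho> B d. rep s \<rho> \<longrightarrow> (\<forall>r. \<rho> r \<le> B) \<longrightarrow> (\<forall>r \<ge> k. \<rho> r = 0) \<longrightarrow>
     d < k \<longrightarrow> d \<noteq> 3 \<longrightarrow> d \<notin> vars e \<longrightarrow> 3 < k \<longrightarrow>
     (\<exists>t. exec (compile_expr e d k) s t (s(d := replicate (val e \<rho>) 0 @ s d)) \<and> t \<le> poly p B))"

lemmas expr_timeI = expr_time_def[THEN iffD2, rule_format]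
lemmas expr_timeD = expr_time_def[THEN iffD1, rule_format]

lemma exec_compile_expr:
  assumes "\<forall>r \<in> vars e. register r \<and> r < k"
  shows "\<exists>p. expr_time e k p"
  using assms
proof (induction e arbitrary: k)
  case (Const m)
  have "\<exists>t. exec (compile_expr (Const m) d k) s t (s(d := replicate (val (Const m) \<rho>) 0 @ s d))
      \<and> t \<le> poly [:m + 1:] B" for s \<rho> B d
    using exec_pushes[of m d s] by (intro exI[of _ "m + 1"]) simp
  then show ?case unfolding expr_time_def by (intro exI[of _ "[:m + 1:]"] allI impI)
next
  case (Var r)
  show ?case
  proof (intro exI[of _ "[:2, 7:]"] expr_timeI)
    fix s \<rho> B d
    assume *: "rep s \<rho>" "\<And>r. \<rho> r \<le> B" "\<And>r. k \<le> r \<Longrightarrow> \<rho> r = 0" "d < k" "d \<noteq> 3" "d \<notin> vars (Var r)" "3 < k"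
    then obtain t where "exec (add r d) s t (s(d := replicate (\<rho> r) 0 @ s d))" "t \<le> 7 * \<rho> r + 2"
      using exec_add[of s r "\<rho> r" d] Var by (auto simp: rep_def)
    moreover have "\<rho> r \<le> B" using * by blast
    ultimately show "\<exists>t. exec (compile_expr (Var r) d k) s t (s(d := replicate (val (Var r) \<rho>) 0 @ s d))
        \<and> t \<le> poly [:2, 7:] B"
      by (intro exI[of _ t]) simp
  qed
next
  case (Plus a b)
  from Plus.IH(1)[of k] Plus.prems obtain p where p: "expr_time a k p" by auto
  from Plus.IH(2)[of k] Plus.prems obtain q where q: "expr_time b k q" by auto
  from val_bound obtain v where v: "\<forall>r. \<rho> r \<le> B \<Longrightarrow> val a \<rho> \<le> poly v B" for \<rho> B by blast
  show ?case
  \<comment> \<open>When \<open>b\<close> is evaluated, register \<open>d\<close> has grown by the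
    value of \<open>a\<close>; its time is therefore taken at \<open>B + v(B)\<close>.\<close>
  proof (intro exI[of _ "p + pcompose q ([:0, 1:] + v)"] expr_timeI)
    fix s \<rho> B d
    assume *: "rep s \<rho>" "\<And>r. \<rho> r \<le> B" "\<And>r. k \<le> r \<Longrightarrow> \<rho> r = 0" "d < k" "d \<noteq> 3"
      "d \<notin> vars (Plus a b)" "3 < k"
    let ?s = "s(d := replicate (val a \<rho>) 0 @ s d)" and ?\<rho> = "\<rho>(d := val a \<rho> + \<rho> d)"
    obtain t where t: "exec (compile_expr a d k) s t ?s" "t \<le> poly p B"
      using expr_timeD[OF p *(1-5)] * by auto
    have va: "val a \<rho> \<le> poly v B" using v *(2) by blast
    have "\<rho> r \<le> B + poly v B" "val a \<rho> + \<rho> r \<le> B + poly v B" for r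
      using *(2)[of r] va by linarith+
    then have le: "?\<rho> r \<le> B + poly v B" for r by simp
    have "?\<rho> r = 0" if "k \<le> r" for r using *(3)[OF that] *(4) that by simp
    from expr_timeD[where \<rho> = ?\<rho>, OF q rep_upd[OF *(1,5)] le this *(4,5) _ *(7)] *(6) obtain u where u: "exec (compile_expr b d k) ?s u (?s(d := replicate (val b ?\<rho>) 0 @ ?s d))"
        "u \<le> poly q (B + poly v B)"
      by auto
    have "val b ?\<rho> = val b \<rho>" using * by (intro val_cong) auto
    moreover have "replicate (val (Plus a b) \<rho>) (0 :: symbol)
        = replicate (val b \<rho>) 0 @ replicate (val a \<rho>) 0"
      by (metis add.commute replicate_add val.simps(3))
    ultimately have "?s(d := replicate (val b ?\<rho>) 0 @ ?s d)
        = s(d := replicate (val (Plus a b) \<rho>) 0 @ s d)"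
      by simp
    with exec.Seq[OF t(1) u(1)] show "\<exists>t. exec (compile_expr (Plus a b) d k) s t
        (s(d := replicate (val (Plus a b) \<rho>) 0 @ s d)) \<and> t \<le> poly (p + pcompose q ([:0, 1:] + v)) B"
      using t(2) u(2) by (intro exI[of _ "t + u"]) (simp add: poly_pcompose)
  qed
next
  case (Times a b)
  have wf: "\<forall>r \<in> vars a. register r \<and> r < Suc k" "\<forall>r \<in> vars b. register r \<and> r < Suc k"
    using Times.prems by (auto simp: less_SucI)
  from Times.IH(1)[OF wf(1)] obtain p where p: "expr_time a (Suc k) p" ..
  from Times.IH(2)[OF wf(2)] obtain q where q: "expr_time b (Suc k) q" ..
  from val_bound obtain v where v: "\<forall>r. \<rho> r \<le> B \<Longrightarrow> val a \<rho> \<le> poly v B" for \<rho> B by blast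
  from val_bound obtain w where w: "\<forall>r. \<rho> r \<le> B \<Longrightarrow> val b \<rho> \<le> poly w B" for \<rho> B by blast
  \<comment> \<open>Bounds the registers throughout the loop: the old values, the counter on stack
    \<open>k\<close>, and the partial product accumulated in \<open>d\<close>.\<close>
  define M where "M = [:0, 1:] + v + v * w"
  show ?case
  proof (intro exI[of _ "p + (v * (pcompose q M + [:2:]) + [:1:])"] expr_timeI)
    fix s \<rho> B d
    assume *: "rep s \<rho>" "\<And>r. \<rho> r \<le> B" "\<And>r. k \<le> r \<Longrightarrow> \<rho> r = 0" "d < k" "d \<noteq> 3"
      "d \<notin> vars (Times a b)" "3 < k"
    let ?m = "val a \<rho>" and ?l = "val b \<rho>"
    define S where "S = (\<lambda>i. s(k := replicate i 0, d := replicate ((?m - i) * ?l) 0 @ s d))"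
    have va: "?m \<le> poly v B" and wb: "?l \<le> poly w B" using v w *(2) by blast+
    have k: "s k = []" "register k" "k \<noteq> d" using * by (auto simp: rep_def)
    obtain t where t: "exec (compile_expr a k (Suc k)) s t (s(k := replicate ?m 0))" "t \<le> poly p B"
      using expr_timeD[OF p *(1,2), of k] * Times.prems k by force
    have "\<exists>t. exec (compile_expr b d (Suc k)) ((S (Suc i))(k := tl (S (Suc i) k))) t (S i)
        \<and> t \<le> poly q (poly M B)" if i: "i < ?m" for i
    proof -
      let ?s = "(S (Suc i))(k := tl (S (Suc i) k))"
      let ?\<rho> = "\<rho>(k := i, d := (?m - Suc i) * ?l + \<rho> d)"
      have "rep ?s ?\<rho>" using * k by (auto simp: rep_def S_def replicate_add)
      have "?m * ?l \<le> poly v B * poly w B"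
        using va wb by (rule mult_mono) auto
      then have "(?m - Suc i) * ?l \<le> poly v B * poly w B"
        by (meson diff_le_self le_trans mult_le_mono1)
      then have "(?m - Suc i) * ?l + \<rho> d \<le> poly M B"
        using *(2)[of d] by (simp add: M_def)
      moreover have "\<rho> r \<le> poly M B" for r
        using *(2)[of r] by (simp add: M_def)
      moreover have "i \<le> poly M B"
        using va i by (simp add: M_def)
      ultimately have "\<forall>r. ?\<rho> r \<le> poly M B" by simp
      moreover note \<open>rep ?s ?\<rho>\<close>
      moreover have "\<forall>r \<ge> Suc k. ?\<rho> r = 0" using * by auto
      ultimately obtain u where u: "exec (compile_expr b d (Suc k)) ?s u
          (?s(d := replicate (val b ?\<rho>) 0 @ ?s d))" "u \<le> poly q (poly M B)"
        using expr_timeD[OF q, of ?s ?\<rho> "poly M B" d] * by auto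
      have "val b ?\<rho> = ?l" using * Times.prems k by (intro val_cong) auto
      moreover have "replicate ((?m - i) * ?l) (0 :: symbol)
          = replicate ?l 0 @ replicate ((?m - Suc i) * ?l) 0"
        using i by (metis Suc_diff_Suc mult_Suc replicate_add)
      ultimately have "?s(d := replicate (val b ?\<rho>) 0 @ ?s d) = S i"
        using k by (auto simp: S_def fun_eq_iff)
      then show ?thesis using u by auto
    qed
    moreover have "length (S i k) = i" for i using k by (simp add: S_def)
    ultimately obtain u where u: "exec (loop k (compile_expr b d (Suc k))) (S ?m) u (S 0)"
        "u \<le> ?m * (poly q (poly M B) + 2) + 1"
      using exec_loop[of ?m S k] by meson
    have "S ?m = s(k := replicate ?m 0)" "S 0 = s(d := replicate (val (Times a b) \<rho>) 0 @ s d)"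
      using k by (auto simp: S_def fun_eq_iff)
    with exec.Seq[OF t(1)] u(1) have "exec (compile_expr (Times a b) d k) s (t + u)
        (s(d := replicate (val (Times a b) \<rho>) 0 @ s d))"
      by auto
    moreover have "?m * (poly q (poly M B) + 2) \<le> poly v B * (poly q (poly M B) + 2)"
      using va by (rule mult_le_mono1)
    ultimately show "\<exists>t. exec (compile_expr (Times a b) d k) s t
        (s(d := replicate (val (Times a b) \<rho>) 0 @ s d))
        \<and> t \<le> poly (p + (v * (pcompose q M + [:2:]) + [:1:])) B"
      using t(2) u(2) by (intro exI[of _ "t + u"]) (simp add: poly_pcompose)
  qed
qed

section \<open>Edge lists generated by nested loops\<close>

definition encode_edges :: "(nat \<times> nat) list \<Rightarrow> symbol list" where
  "encode_edges es = concat (map encode_nat (concat (map (\<lambda>(u, v). [u, v]) es)))"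

lemma encode_edges_simps [simp]:
  "encode_edges [] = []"
  "encode_edges (es @ es') = encode_edges es @ encode_edges es'"
  by (simp_all add: encode_edges_def)

text \<open>
  The variable of a \<open>For\<close> loop counts down, so that it can serve as the loop counter. Stacks 11 to 13 are
  set aside for these variables, and the stacks from 14 on for temporaries.
\<close>

datatype edge_list = Edge expr expr | Both edge_list edge_list | For stack expr edge_list

primrec edges :: "edge_list \<Rightarrow> (stack \<Rightarrow> nat) \<Rightarrow> (nat \<times> nat) list" where
  "edges (Edge a b) \<rho> = [(val a \<rho>, val b \<rho>)]"
| "edges (Both c d) \<rho> = edges c \<rho> @ edges d \<rho>"
| "edges (For i e c) \<rho> = concat (map (\<lambda>v. edges c (\<rho>(i := v))) (rev [0..<val e \<rho>]))"

primrec bound_vars :: "edge_list \<Rightarrow> stack set" where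
  "bound_vars (Edge a b) = {}"
| "bound_vars (Both c d) = bound_vars c \<union> bound_vars d"
| "bound_vars (For i e c) = insert i (bound_vars c)"

abbreviation wf_expr :: "expr \<Rightarrow> bool" where
  "wf_expr e \<equiv> \<forall>r \<in> vars e. register r \<and> r < 14"

primrec wf_edge_list :: "edge_list \<Rightarrow> bool" where
  "wf_edge_list (Edge a b) \<longleftrightarrow> wf_expr a \<and> wf_expr b"
| "wf_edge_list (Both c d) \<longleftrightarrow> wf_edge_list c \<and> wf_edge_list d"
| "wf_edge_list (For i e c) \<longleftrightarrow> i \<in> {11, 12, 13} \<and> i \<notin> vars e \<and> i \<notin> bound_vars c
    \<and> wf_expr e \<and> wf_edge_list c"

primrec compile_edges :: "edge_list \<Rightarrow> program" where
  "compile_edges (Edge a b) =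
    Seq (Seq (compile_expr a 2 14) (Push 2 1)) (Seq (compile_expr b 2 14) (Push 2 1))"
| "compile_edges (Both c d) = Seq (compile_edges c) (compile_edges d)"
| "compile_edges (For i e c) = Seq (compile_expr e i 14) (loop i (compile_edges c))"

lemma rep_output [simp]: "rep (s(2 := xs)) \<rho> \<longleftrightarrow> rep s \<rho>"
  by (simp add: rep_def)

lemma wf_edge_list_bound_vars: "wf_edge_list c \<Longrightarrow> i \<in> bound_vars c \<Longrightarrow> i \<in> {11, 12, 13}"
  by (induction c) auto

text \<open>Loop variables are 0 on entry because a \<open>For\<close> adds its range to the stack
  of its variable; the loop brings it back to 0, so a body can be repeated. The output stack holds
  the text in reverse, with the last symbol on top.\<close>

definition edges_time :: "edge_list \<Rightarrow> nat poly \<Rightarrow> bool" where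
  "edges_time c p \<longleftrightarrow> (\<forall>s \<rho> B. rep s \<rho> \<longrightarrow> (\<forall>r. \<rho> r \<le> B) \<longrightarrow> (\<forall>r \<ge> 14. \<rho> r = 0) \<longrightarrow>
     (\<forall>i \<in> bound_vars c. \<rho> i = 0) \<longrightarrow>
     (\<exists>t. exec (compile_edges c) s t (s(2 := rev (encode_edges (edges c \<rho>)) @ s 2)) \<and> t \<le> poly p B))"

lemmas edges_timeI = edges_time_def[THEN iffD2, rule_format]
lemmas edges_timeD = edges_time_def[THEN iffD1, rule_format]

lemma exec_compile_edges:
  assumes "wf_edge_list c"
  shows "\<exists>p. edges_time c p"
  using assms
proof (induction c)
  case (Edge a b)
  then obtain p q where p: "expr_time a 14 p" and q: "expr_time b 14 q"
    using exec_compile_expr[of a 14] exec_compile_expr[of b 14] by auto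
  have d: "(2 :: stack) < 14" "(2 :: stack) \<noteq> 3" "2 \<notin> vars a" "2 \<notin> vars b" "(3 :: stack) < 14"
    using Edge by auto
  show ?case
  proof (intro exI[of _ "p + q + [:2:]"] edges_timeI)
    fix s \<rho> B
    assume *: "rep s \<rho>" "\<And>r. \<rho> r \<le> B" "\<And>r. 14 \<le> r \<Longrightarrow> \<rho> r = 0"
    let ?s = "s(2 := replicate (val a \<rho>) 0 @ s 2)"
    let ?s' = "?s(2 := 1 # ?s 2)"
    let ?u = "?s'(2 := replicate (val b \<rho>) 0 @ ?s' 2)"
    obtain t where t: "exec (compile_expr a 2 14) s t ?s" "t \<le> poly p B"
      using expr_timeD[OF p * d(1,2,3,5)] by blast
    have "rep ?s' \<rho>" using * by simp
    from expr_timeD[OF q this *(2,3) d(1,2,4,5)] obtain u where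
      u: "exec (compile_expr b 2 14) ?s' u ?u" "u \<le> poly q B"
      by blast
    have "?u(2 := 1 # ?u 2) = s(2 := rev (encode_edges (edges (Edge a b) \<rho>)) @ s 2)"
      by (simp add: encode_edges_def encode_nat_def)
    with exec.Seq[OF exec.Seq[OF t(1) exec.Push] exec.Seq[OF u(1) exec.Push[of 2 1]]]
    have "exec (compile_edges (Edge a b)) s ((t + 1) + (u + 1))
        (s(2 := rev (encode_edges (edges (Edge a b) \<rho>)) @ s 2))"
      unfolding compile_edges.simps by (simp only:)
    then show "\<exists>t. exec (compile_edges (Edge a b)) s t
        (s(2 := rev (encode_edges (edges (Edge a b) \<rho>)) @ s 2)) \<and> t \<le> poly (p + q + [:2:]) B"
      using t(2) u(2) by (intro exI[of _ "(t + 1) + (u + 1)"]) simp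
  qed
next
  case (Both c d)
  then obtain p q where p: "edges_time c p" and q: "edges_time d q" by auto
  show ?case
  proof (intro exI[of _ "p + q"] edges_timeI)
    fix s \<rho> B
    assume *: "rep s \<rho>" "\<And>r. \<rho> r \<le> B" "\<And>r. 14 \<le> r \<Longrightarrow> \<rho> r = 0" "\<And>i. i \<in> bound_vars (Both c d) \<Longrightarrow> \<rho> i = 0"
    let ?s = "s(2 := rev (encode_edges (edges c \<rho>)) @ s 2)"
    obtain t where t: "exec (compile_edges c) s t ?s" "t \<le> poly p B"
      using edges_timeD[OF p *(1-3)] *(4) by auto
    have "rep ?s \<rho>" using * by simp
    from edges_timeD[OF q this *(2,3)] *(4) obtain u where u: "exec (compile_edges d) ?s u
        (?s(2 := rev (encode_edges (edges d \<rho>)) @ ?s 2))" "u \<le> poly q B"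
      by auto
    from exec.Seq[OF t(1) u(1)] have "exec (compile_edges (Both c d)) s (t + u)
        (s(2 := rev (encode_edges (edges (Both c d) \<rho>)) @ s 2))"
      by simp
    then show "\<exists>t. exec (compile_edges (Both c d)) s t
        (s(2 := rev (encode_edges (edges (Both c d) \<rho>)) @ s 2)) \<and> t \<le> poly (p + q) B"
      using t(2) u(2) by (intro exI[of _ "t + u"]) simp
  qed
next
  case (For i e c)
  then obtain p q where p: "edges_time c p" and q: "expr_time e 14 q"
    using exec_compile_expr[of e 14] by auto
  from val_bound obtain v where v: "\<forall>r. \<rho> r \<le> B \<Longrightarrow> val e \<rho> \<le> poly v B" for \<rho> B by blast
  define M where "M = [:0, 1:] + v"
  show ?case
  proof (intro exI[of _ "q + (v * (pcompose p M + [:2:]) + [:1:])"] edges_timeI)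
    fix s \<rho> B
    assume *: "rep s \<rho>" "\<And>r. \<rho> r \<le> B" "\<And>r. 14 \<le> r \<Longrightarrow> \<rho> r = 0"
      "\<And>j. j \<in> bound_vars (For i e c) \<Longrightarrow> \<rho> j = 0"
    let ?m = "val e \<rho>"
    \<comment> \<open>The output of the rounds for \<open>?m - 1\<close> down to \<open>j\<close>,
      that is, when \<open>j\<close> rounds are left.\<close>
    let ?out = "\<lambda>j. encode_edges (concat (map (\<lambda>v. edges c (\<rho>(i := v))) (rev [j..<?m])))"
    define S where "S = (\<lambda>j. s(i := replicate j 0, 2 := rev (?out j) @ s 2))"
    have vm: "?m \<le> poly v B" using v *(2) by blast
    have i: "i \<noteq> 2" "i \<noteq> 3" "register i" "i < 14"
      using wf_edge_list_bound_vars[OF For.prems, of i] by auto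
    have ie: "i \<notin> vars e" "i \<notin> bound_vars c" using For.prems by simp_all
    have "\<rho> i = 0" using *(4)[of i] by simp
    then have si: "s i = []" using *(1) i(3) by (simp add: rep_def)
    obtain t where t: "exec (compile_expr e i 14) s t (s(i := replicate ?m 0))" "t \<le> poly q B"
      using expr_timeD[OF q *(1-3) i(4,2) ie(1)] si by auto
    have "\<exists>t. exec (compile_edges c) ((S (Suc j))(i := tl (S (Suc j) i))) t (S j)
        \<and> t \<le> poly p (poly M B)" if j: "j < ?m" for j
    proof -
      let ?s = "(S (Suc j))(i := tl (S (Suc j) i))" and ?\<rho> = "\<rho>(i := j)"
      have rep: "rep ?s ?\<rho>" using *(1) i(1-3) by (auto simp: rep_def S_def)
      have le: "?\<rho> r \<le> poly M B" for r
        using *(2)[of r] vm j by (auto simp: M_def)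
      have zero: "?\<rho> r = 0" if "14 \<le> r" for r using *(3)[OF that] i that by auto
      have "?\<rho> l = 0" if "l \<in> bound_vars c" for l using *(4)[of l] ie that by auto
      from edges_timeD[where \<rho> = ?\<rho>, OF p rep le zero this] obtain u where
        u: "exec (compile_edges c) ?s u (?s(2 := rev (encode_edges (edges c ?\<rho>)) @ ?s 2))"
          "u \<le> poly p (poly M B)"
        by blast
      have out: "?out j = ?out (Suc j) @ encode_edges (edges c ?\<rho>)"
        by (simp add: upt_conv_Cons[OF j])
      have "?s(2 := rev (encode_edges (edges c ?\<rho>)) @ ?s 2) = S j"
        using i(1,2) out by (simp add: S_def fun_eq_iff)
      then show ?thesis using u by auto
    qed
    moreover have "length (S j i) = j" for j using i(1) by (simp add: S_def)
    ultimately obtain u where u: "exec (loop i (compile_edges c)) (S ?m) u (S 0)"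
        "u \<le> ?m * (poly p (poly M B) + 2) + 1"
      using exec_loop[of ?m S i] by meson
    have "S ?m = s(i := replicate ?m 0)"
      "S 0 = s(2 := rev (encode_edges (edges (For i e c) \<rho>)) @ s 2)"
      using i(1,2) si by (auto simp: S_def fun_eq_iff)
    with exec.Seq[OF t(1), of "loop i (compile_edges c)"] u(1)
    have "exec (compile_edges (For i e c)) s (t + u)
        (s(2 := rev (encode_edges (edges (For i e c) \<rho>)) @ s 2))"
      by (simp only: compile_edges.simps)
    moreover have "?m * (poly p (poly M B) + 2) \<le> poly v B * (poly p (poly M B) + 2)"
      using vm by (rule mult_le_mono1)
    ultimately show "\<exists>t. exec (compile_edges (For i e c)) s t
        (s(2 := rev (encode_edges (edges (For i e c) \<rho>)) @ s 2))
        \<and> t \<le> poly (q + (v * (pcompose p M + [:2:]) + [:1:])) B"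
      using t(2) u(2) by (intro exI[of _ "t + u"]) (simp add: poly_pcompose)
  qed
qed

section \<open>Statements with registers and output\<close>

datatype statement =
    Edges edge_list
  | Symbol symbol
  | AddTo stack expr
  | Dec stack
  | Clear stack
  | If0 stack statement statement
  | Then statement statement (infixr ";;" 60)

primrec run :: "statement \<Rightarrow> (stack \<Rightarrow> nat) \<times> symbol list \<Rightarrow> (stack \<Rightarrow> nat) \<times> symbol list" where
  "run (Edges c) \<sigma> = (fst \<sigma>, snd \<sigma> @ encode_edges (edges c (fst \<sigma>)))"
| "run (Symbol a) \<sigma> = (fst \<sigma>, snd \<sigma> @ [a])"
| "run (AddTo r e) \<sigma> = ((fst \<sigma>)(r := val e (fst \<sigma>) + fst \<sigma> r), snd \<sigma>)"
| "run (Dec r) \<sigma> = ((fst \<sigma>)(r := fst \<sigma> r - 1), snd \<sigma>)"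
| "run (Clear r) \<sigma> = ((fst \<sigma>)(r := 0), snd \<sigma>)"
| "run (If0 r c d) \<sigma> = (if fst \<sigma> r = 0 then run c \<sigma> else run d \<sigma>)"
| "run (c ;; d) \<sigma> = run d (run c \<sigma>)"

primrec wf_statement :: "statement \<Rightarrow> bool" where
  "wf_statement (Edges c) \<longleftrightarrow> wf_edge_list c"
| "wf_statement (Symbol a) \<longleftrightarrow> True"
| "wf_statement (AddTo r e) \<longleftrightarrow> register r \<and> r < 11 \<and> wf_expr e \<and> r \<notin> vars e"
| "wf_statement (Dec r) \<longleftrightarrow> register r \<and> r < 11"
| "wf_statement (Clear r) \<longleftrightarrow> register r \<and> r < 11"
| "wf_statement (If0 r c d) \<longleftrightarrow> register r \<and> wf_statement c \<and> wf_statement d"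
| "wf_statement (c ;; d) \<longleftrightarrow> wf_statement c \<and> wf_statement d"

primrec compile :: "statement \<Rightarrow> program" where
  "compile (Edges c) = compile_edges c"
| "compile (Symbol a) = Push 2 a"
| "compile (AddTo r e) = compile_expr e r 14"
| "compile (Dec r) = Pop r"
| "compile (Clear r) = clear r"
| "compile (If0 r c d) = Cond (Emp r) (compile c) (compile d)"
| "compile (c ;; d) = Seq (compile c) (compile d)"

definition represents :: "state \<Rightarrow> (stack \<Rightarrow> nat) \<times> symbol list \<Rightarrow> bool" where
  "represents s \<sigma> \<longleftrightarrow> rep s (fst \<sigma>) \<and> s 2 = rev (snd \<sigma>)"

text \<open>One number bounds both the time and the registers afterwards. This makes the bound
  compositional: in \<open>c ;; d\<close> the bound for \<open>c\<close> is the register bound with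
  which \<open>d\<close> starts.\<close>

definition runs :: "statement \<Rightarrow> state \<Rightarrow> (stack \<Rightarrow> nat) \<times> symbol list \<Rightarrow> nat \<Rightarrow> bool" where
  "runs c s \<sigma> T \<longleftrightarrow> (\<exists>t s'. exec (compile c) s t s' \<and> t \<le> T \<and> represents s' (run c \<sigma>) \<and> s' 0 = s 0)
     \<and> (\<forall>r. fst (run c \<sigma>) r \<le> T) \<and> (\<forall>r \<ge> 11. fst (run c \<sigma>) r = 0)"

lemma runsI:
  assumes "exec (compile c) s t s'" "t \<le> T" "represents s' (run c \<sigma>)" "s' 0 = s 0"
    and "\<And>r. fst (run c \<sigma>) r \<le> T" "\<And>r. 11 \<le> r \<Longrightarrow> fst (run c \<sigma>) r = 0"
  shows "runs c s \<sigma> T"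
  using assms unfolding runs_def by blast

lemma runsE:
  assumes "runs c s \<sigma> T"
  obtains t s' where "exec (compile c) s t s'" "t \<le> T" "represents s' (run c \<sigma>)" "s' 0 = s 0"
    and "\<And>r. fst (run c \<sigma>) r \<le> T" "\<And>r. 11 \<le> r \<Longrightarrow> fst (run c \<sigma>) r = 0"
  using assms unfolding runs_def by blast

definition statement_time :: "statement \<Rightarrow> nat poly \<Rightarrow> bool" where
  "statement_time c p \<longleftrightarrow> (\<forall>s \<sigma> B. represents s \<sigma> \<longrightarrow> (\<forall>r. fst \<sigma> r \<le> B) \<longrightarrow>
     (\<forall>r \<ge> 11. fst \<sigma> r = 0) \<longrightarrow> runs c s \<sigma> (poly p B))"

lemmas statement_timeI = statement_time_def[THEN iffD2, rule_format]
lemmas statement_timeD = statement_time_def[THEN iffD1, rule_format]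

lemma exec_compile:
  assumes "wf_statement c"
  shows "\<exists>p. statement_time c p"
  using assms
proof (induction c)
  case (Edges c)
  then have wf: "wf_edge_list c" by simp
  from exec_compile_edges[OF wf] obtain p where p: "edges_time c p" ..
  show ?case
  proof (intro exI[of _ "p + [:0, 1:]"] statement_timeI)
    fix s \<sigma> B
    assume *: "represents s \<sigma>" "\<And>r. fst \<sigma> r \<le> B" "\<And>r. 11 \<le> r \<Longrightarrow> fst \<sigma> r = 0"
    have "fst \<sigma> i = 0" if "i \<in> bound_vars c" for i
      using *(3)[of i] wf_edge_list_bound_vars[OF wf that] by auto
    with edges_timeD[OF p, of s "fst \<sigma>" B] * obtain t where
      t: "exec (compile_edges c) s t (s(2 := rev (encode_edges (edges c (fst \<sigma>))) @ s 2))" "t \<le> poly p B"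
      by (auto simp: represents_def)
    show "runs (Edges c) s \<sigma> (poly (p + [:0, 1:]) B)"
      by (rule runsI[of _ _ t "s(2 := rev (encode_edges (edges c (fst \<sigma>))) @ s 2)"])
        (use t * in \<open>auto simp: represents_def trans_le_add2\<close>)
  qed
next
  case (Symbol a)
  show ?case
  proof (intro exI[of _ "[:1, 1:]"] statement_timeI)
    fix s \<sigma> B
    assume *: "represents s \<sigma>" "\<And>r. fst \<sigma> r \<le> B" "\<And>r. 11 \<le> r \<Longrightarrow> fst \<sigma> r = 0"
    show "runs (Symbol a) s \<sigma> (poly [:1, 1:] B)"
      by (rule runsI[of _ _ 1 "s(2 := a # s 2)"])
        (use * exec.Push[of 2 a s] in \<open>auto simp: represents_def le_SucI\<close>)
  qed
next
  case (AddTo r e)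
  with exec_compile_expr[of e 14] obtain q where q: "expr_time e 14 q" by auto
  from val_bound obtain v where v: "\<forall>r. \<rho> r \<le> B \<Longrightarrow> val e \<rho> \<le> poly v B" for \<rho> B by blast
  show ?case
  proof (intro exI[of _ "q + v + [:0, 1:]"] statement_timeI)
    fix s \<sigma> B
    assume *: "represents s \<sigma>" "\<And>r. fst \<sigma> r \<le> B" "\<And>r. 11 \<le> r \<Longrightarrow> fst \<sigma> r = 0"
    let ?s = "s(r := replicate (val e (fst \<sigma>)) 0 @ s r)"
    from expr_timeD[OF q, of s "fst \<sigma>" B r] * AddTo obtain t where
      t: "exec (compile_expr e r 14) s t ?s" "t \<le> poly q B"
      by (auto simp: represents_def)
    have "represents ?s (run (AddTo r e) \<sigma>)"
      using * AddTo rep_upd[of s "fst \<sigma>" r "val e (fst \<sigma>)"] by (auto simp: represents_def)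
    moreover have "val e (fst \<sigma>) \<le> poly v B" using v *(2) by blast
    moreover from this have "fst (run (AddTo r e) \<sigma>) r' \<le> poly (q + v + [:0, 1:]) B" for r'
      using *(2)[of r'] by auto
    ultimately show "runs (AddTo r e) s \<sigma> (poly (q + v + [:0, 1:]) B)"
      by (intro runsI[of _ _ t ?s]) (use t * AddTo in auto)
  qed
next
  case (Dec r)
  show ?case
  proof (intro exI[of _ "[:1, 1:]"] statement_timeI)
    fix s \<sigma> B
    assume *: "represents s \<sigma>" "\<And>r. fst \<sigma> r \<le> B" "\<And>r. 11 \<le> r \<Longrightarrow> fst \<sigma> r = 0"
    have "fst \<sigma> r - 1 \<le> Suc B" using *(2)[of r] by simp
    moreover have "represents (s(r := tl (s r))) (run (Dec r) \<sigma>)"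
      using * Dec by (auto simp: represents_def rep_def)
    ultimately show "runs (Dec r) s \<sigma> (poly [:1, 1:] B)"
      by (intro runsI[of _ _ 1 "s(r := tl (s r))"])
        (use * Dec exec.Pop[of r s] in \<open>auto simp: le_SucI\<close>)
  qed
next
  case (Clear r)
  show ?case
  proof (intro exI[of _ "[:1, 2:]"] statement_timeI)
    fix s \<sigma> B
    assume *: "represents s \<sigma>" "\<And>r. fst \<sigma> r \<le> B" "\<And>r. 11 \<le> r \<Longrightarrow> fst \<sigma> r = 0"
    have "length (s r) \<le> B" using * Clear by (auto simp: represents_def rep_def)
    moreover have "represents (s(r := [])) (run (Clear r) \<sigma>)"
      using * Clear by (auto simp: represents_def rep_def)
    moreover have "fst (run (Clear r) \<sigma>) r' \<le> poly [:1, 2:] B" for r'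
      using *(2)[of r'] by simp
    ultimately show "runs (Clear r) s \<sigma> (poly [:1, 2:] B)"
      by (intro runsI[of _ _ "2 * length (s r) + 1" "s(r := [])"])
        (use * Clear exec_clear[of r s] in auto)
  qed
next
  case (If0 r c d)
  then obtain p q where p: "statement_time c p" and q: "statement_time d q" by auto
  show ?case
  proof (intro exI[of _ "p + q + [:1:]"] statement_timeI)
    fix s \<sigma> B
    assume *: "represents s \<sigma>" "\<And>r. fst \<sigma> r \<le> B" "\<And>r. 11 \<le> r \<Longrightarrow> fst \<sigma> r = 0"
    have r: "s r = [] \<longleftrightarrow> fst \<sigma> r = 0" using *(1) If0.prems by (auto simp: represents_def rep_def)
    show "runs (If0 r c d) s \<sigma> (poly (p + q + [:1:]) B)"
    proof (cases "fst \<sigma> r = 0")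
      case True
      from statement_timeD[OF p *] show ?thesis
      proof (rule runsE)
        fix t s'
        assume t: "exec (compile c) s t s'" "t \<le> poly p B" "represents s' (run c \<sigma>)" "s' 0 = s 0"
          "\<And>r. fst (run c \<sigma>) r \<le> poly p B" "\<And>r. 11 \<le> r \<Longrightarrow> fst (run c \<sigma>) r = 0"
        have "fst (run c \<sigma>) r' \<le> poly (p + q + [:1:]) B" for r' using t(5)[of r'] by simp
        then show ?thesis
          by (intro runsI[of _ _ "Suc t" s'])
            (use True r t CondTrue[of "Emp r" s "compile c" t s' "compile d"] in auto)
      qed
    next
      case False
      from statement_timeD[OF q *] show ?thesis
      proof (rule runsE)
        fix t s'
        assume t: "exec (compile d) s t s'" "t \<le> poly q B" "represents s' (run d \<sigma>)" "s' 0 = s 0"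
          "\<And>r. fst (run d \<sigma>) r \<le> poly q B" "\<And>r. 11 \<le> r \<Longrightarrow> fst (run d \<sigma>) r = 0"
        have "fst (run d \<sigma>) r' \<le> poly (p + q + [:1:]) B" for r' using t(5)[of r'] by simp
        then show ?thesis
          by (intro runsI[of _ _ "Suc t" s'])
            (use False r t CondFalse[of "Emp r" s "compile d" t s' "compile c"] in auto)
      qed
    qed
  qed
next
  case (Then c d)
  then obtain p q where p: "statement_time c p" and q: "statement_time d q" by auto
  show ?case
  proof (intro exI[of _ "p + pcompose q p"] statement_timeI)
    fix s \<sigma> B
    assume *: "represents s \<sigma>" "\<And>r. fst \<sigma> r \<le> B" "\<And>r. 11 \<le> r \<Longrightarrow> fst \<sigma> r = 0"
    obtain t s' where t: "exec (compile c) s t s'" "t \<le> poly p B"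
      "represents s' (run c \<sigma>)" "s' 0 = s 0" "\<And>r. fst (run c \<sigma>) r \<le> poly p B"
      "\<And>r. 11 \<le> r \<Longrightarrow> fst (run c \<sigma>) r = 0"
      using statement_timeD[OF p *] unfolding runs_def by blast
    obtain u s'' where u: "exec (compile d) s' u s''" "u \<le> poly q (poly p B)"
      "represents s'' (run d (run c \<sigma>))" "s'' 0 = s' 0"
      "\<And>r. fst (run d (run c \<sigma>)) r \<le> poly q (poly p B)"
      "\<And>r. 11 \<le> r \<Longrightarrow> fst (run d (run c \<sigma>)) r = 0"
      using statement_timeD[OF q t(3,5,6)] unfolding runs_def by blast
    show "runs (c ;; d) s \<sigma> (poly (p + pcompose q p) B)"
      by (rule runsI[of _ _ "t + u" s''])
        (use exec.Seq[OF t(1) u(1)] t u in \<open>auto simp: poly_pcompose trans_le_add2\<close>)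
  qed
qed

section \<open>The graph of a Hitting Set instance\<close>

datatype label = Left | Right | Cut

definition compatible :: "label \<Rightarrow> label \<Rightarrow> bool" where
  "compatible a b \<longleftrightarrow> (if a = Cut then b \<noteq> Cut else b = a \<or> b = Cut)"

lemma compatible_simps [simp]:
  "compatible Cut b \<longleftrightarrow> b \<noteq> Cut" "compatible a Cut \<longleftrightarrow> a \<noteq> Cut"
  "compatible Left b \<longleftrightarrow> b \<noteq> Right" "compatible a Left \<longleftrightarrow> a \<noteq> Right"
  "compatible Right b \<longleftrightarrow> b \<noteq> Left" "compatible a Right \<longleftrightarrow> a \<noteq> Left"
  by (cases a; cases b; simp add: compatible_def)+

definition proper :: "('v \<Rightarrow> label) \<Rightarrow> ('v \<times> 'v) list \<Rightarrow> bool" where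
  "proper l es \<longleftrightarrow> (\<forall>(u, v) \<in> set es. compatible (l u) (l v))"

lemma proper_simps [simp]:
  "proper l []"
  "proper l ((u, v) # es) \<longleftrightarrow> compatible (l u) (l v) \<and> proper l es"
  "proper l (es @ es') \<longleftrightarrow> proper l es \<and> proper l es'"
  by (auto simp: proper_def)

lemma simple_graph_of:
  "simple_graph (graph_of n es) \<longleftrightarrow> (\<forall>(u, v) \<in> set es. u < n \<and> v < n \<and> u \<noteq> v)"
proof -
  have edge: "(\<exists>a \<in> {..<n}. \<exists>b \<in> {..<n}. a \<noteq> b \<and> {u, v} = {a, b}) \<longleftrightarrow> u < n \<and> v < n \<and> u \<noteq> v"
    for u v
    unfolding doubleton_eq_iff by blast
  have "(\<forall>e \<in> {{u, v} | u v. (u, v) \<in> A}. P e) \<longleftrightarrow> (\<forall>(u, v) \<in> A. P {u, v})"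
    for A :: "(nat \<times> nat) set" and P
    by blast
  then show ?thesis
    unfolding simple_graph_def graph_of_def split_conv by (simp only: edge) simp
qed

text \<open>Given a cutset, \<open>Left\<close> is what a fixed vertex reaches outside it, and
  \<open>Right\<close> is the rest. Conversely, an edge that avoids the vertices labelled
  \<open>Cut\<close> cannot leave the side \<open>Left\<close>. Labels of numbers from
  \<open>n\<close> on are arbitrary, which is why both sides are required to occur below
  \<open>n\<close>.\<close>

lemma stable_cutset_iff_labelling:
  assumes "simple_graph (graph_of n es)"
  shows "(\<exists>S. stable_cutset (graph_of n es) S) \<longleftrightarrow>
    (\<exists>l. proper l es \<and> Left \<in> l ` {..<n} \<and> Right \<in> l ` {..<n})"
proof
  assume "\<exists>S. stable_cutset (graph_of n es) S"
  then obtain S where S: "stable_cutset (graph_of n es) S" ..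
  define R where "R = {(a, b). {a, b} \<in> {e \<in> snd (graph_of n es). e \<inter> S = {}}}"
  from S obtain u v where uv: "u \<in> {..<n} - S" "v \<in> {..<n} - S" "(u, v) \<notin> R\<^sup>*"
    by (auto simp: stable_cutset_def disconnected_def delete_vertices_def graph_of_def R_def)
  define l where "l x = (if x \<in> S then Cut else if (u, x) \<in> R\<^sup>* then Left else Right)" for x
  have "compatible (l a) (l b)" if ab: "(a, b) \<in> set es" for a b
  proof -
    have "{a, b} \<in> snd (graph_of n es)" using ab by (auto simp: graph_of_def)
    then have "(a, b) \<in> R \<and> (b, a) \<in> R" if "a \<notin> S" "b \<notin> S"
      using that by (auto simp: R_def insert_commute)
    moreover have "\<not> (a \<in> S \<and> b \<in> S)"
      using S \<open>{a, b} \<in> snd (graph_of n es)\<close> by (auto simp: stable_cutset_def)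
    ultimately show ?thesis
      by (auto simp: l_def intro: rtrancl_into_rtrancl)
  qed
  moreover have "l u = Left" "l v = Right" using uv by (auto simp: l_def)
  ultimately show "\<exists>l. proper l es \<and> Left \<in> l ` {..<n} \<and> Right \<in> l ` {..<n}"
    using uv by (intro exI[of _ l]) (force simp: proper_def)
next
  assume "\<exists>l. proper l es \<and> Left \<in> l ` {..<n} \<and> Right \<in> l ` {..<n}"
  then obtain l u v where l: "proper l es" and uv: "u < n" "l u = Left" "v < n" "l v = Right"
    by force
  define S where "S = {x. x < n \<and> l x = Cut}"
  define R where "R = {(a, b). {a, b} \<in> {e \<in> snd (graph_of n es). e \<inter> S = {}}}"
  have edge: "compatible (l a) (l b)" if "{a, b} \<in> snd (graph_of n es)" for a b
  proof -
    from that have "(a, b) \<in> set es \<or> (b, a) \<in> set es"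
      by (auto simp: graph_of_def doubleton_eq_iff)
    with l have "compatible (l a) (l b) \<or> compatible (l b) (l a)" by (auto simp: proper_def)
    then show ?thesis by (auto simp: compatible_def split: if_splits)
  qed
  have R: "l b = Left" if "(a, b) \<in> R" "l a = Left" for a b
  proof -
    have ab: "{a, b} \<in> snd (graph_of n es)" "b \<notin> S" using that by (auto simp: R_def)
    moreover have "b < n"
      using assms ab(1) unfolding simple_graph_of by (auto simp: graph_of_def doubleton_eq_iff)
    ultimately have "l b \<noteq> Cut" by (simp add: S_def)
    with edge[OF ab(1)] that(2) show ?thesis by (cases "l b") auto
  qed
  have "l x = Left" if "(u, x) \<in> R\<^sup>*" for x
    using that by (induction rule: rtrancl_induct) (auto simp: uv R)
  then have "(u, v) \<notin> R\<^sup>*" using uv by auto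
  moreover have "u \<notin> S" "v \<notin> S" using uv by (auto simp: S_def)
  ultimately have "disconnected (delete_vertices (graph_of n es) S)"
    using uv by (auto simp: disconnected_def delete_vertices_def graph_of_def R_def)
  moreover have "{a, b} \<notin> snd (graph_of n es)" if "a \<in> S" "b \<in> S" for a b
    using edge[of a b] that by (auto simp: S_def)
  ultimately have "stable_cutset (graph_of n es) S"
    by (auto simp: stable_cutset_def graph_of_def S_def)
  then show "\<exists>S. stable_cutset (graph_of n es) S" ..
qed

text \<open>
  The vertices 0 and 1 lie in one component, 2 and 3 in the other, and 4 is in the cutset.
  \<open>pick n e j\<close> is in the cutset iff the element \<open>e\<close> fills slot \<open>j\<close> of the
  hitting set, and then \<open>switch n e j\<close> is in the component of 2; otherwise it is in the cutset.
\<close>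

definition pick :: "nat \<Rightarrow> nat \<Rightarrow> nat \<Rightarrow> nat" where
  "pick n e j = 5 + e * n + j"

definition switch :: "nat \<Rightarrow> nat \<Rightarrow> nat \<Rightarrow> nat" where
  "switch n e j = 5 + n * n + e * n + j"

text \<open>Both the number of modulator vertices (five special ones and two for each pair of
  element and slot) and the number of the first path vertex.\<close>

definition base :: "nat \<Rightarrow> nat" where
  "base n = 5 + 2 * n * n"

text \<open>For budget \<open>k\<close>, blocking the first \<open>d = n - k\<close> (truncated) of the \<open>n\<close> slots leaves \<open>min n k\<close> of them.\<close>

definition gadget_edges :: "nat \<Rightarrow> nat \<Rightarrow> (nat \<times> nat) list" where
  "gadget_edges n d =
    [(0, 1), (0, 4), (1, 4), (2, 3), (2, 4), (3, 4), (base n, 0), (base n, 4)] @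
    concat (map (\<lambda>e. concat (map (\<lambda>j.
      [(0, pick n e j), (1, pick n e j), (2, switch n e j), (3, switch n e j), (pick n e j, switch n e j)])
      (rev [0..<n]))) (rev [0..<n])) @
    concat (map (\<lambda>e. concat (map (\<lambda>f. concat (map (\<lambda>j.
      [(pick n e j, pick n f j)]) (rev [0..<n]))) (rev [0..<e]))) (rev [0..<n])) @
    concat (map (\<lambda>e. concat (map (\<lambda>j. [(0, switch n e j)]) (rev [0..<d]))) (rev [0..<n]))"

text \<open>
  The sets are laid out as one sequence of tokens, with \<open>None\<close> closing a set. For every set there is
  a path. It begins on the side of 0, ends on the side of 2, and can change sides only
  next to a switch that is not in the cutset.
\<close>

definition element_edges :: "nat \<Rightarrow> nat \<Rightarrow> nat \<Rightarrow> (nat \<times> nat) list" where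
  "element_edges n c e = concat (map (\<lambda>j.
     [(c + 2 * j, c + 2 * j + 1), (c + 2 * j + 1, c + 2 * j + 2), (c + 2 * j + 1, switch n e j),
      (c + 2 * j + 2, switch n e j), (c + 2 * j + 2, 4)]) (rev [0..<n]))"

fun path_end :: "nat \<Rightarrow> nat \<Rightarrow> nat option list \<Rightarrow> nat" where
  "path_end n c [] = c"
| "path_end n c (Some e # ts) = path_end n (c + 2 * n) ts"
| "path_end n c (None # ts) = path_end n (c + 1) ts"

fun token_edges :: "nat \<Rightarrow> nat \<Rightarrow> nat option list \<Rightarrow> (nat \<times> nat) list" where
  "token_edges n c [] = []"
| "token_edges n c (Some e # ts) = element_edges n c e @ token_edges n (c + 2 * n) ts"
| "token_edges n c (None # ts) = [(c, 2), (c + 1, 0), (c + 1, 4)] @ token_edges n (c + 1) ts"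

text \<open>The flag \<open>b\<close> says whether the current set has been hit already. A set is
  judged only at the \<open>None\<close> that closes it.\<close>

fun all_hit :: "(nat \<Rightarrow> bool) \<Rightarrow> bool \<Rightarrow> nat option list \<Rightarrow> bool" where
  "all_hit h b [] \<longleftrightarrow> True"
| "all_hit h b (Some e # ts) \<longleftrightarrow> all_hit h (b \<or> h e) ts"
| "all_hit h b (None # ts) \<longleftrightarrow> b \<and> all_hit h False ts"

definition tokens :: "nat list list \<Rightarrow> nat option list" where
  "tokens Fs = concat (map (\<lambda>F. map Some F @ [None]) Fs)"

lemma all_hit_cong:
  "(\<And>e. Some e \<in> set ts \<Longrightarrow> h e \<longleftrightarrow> h' e) \<Longrightarrow> all_hit h b ts \<longleftrightarrow> all_hit h' b ts"
  by (induction h b ts rule: all_hit.induct) auto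

lemma all_hit_map_Some:
  "all_hit h b (map Some F @ None # ts) \<longleftrightarrow> (b \<or> (\<exists>e \<in> set F. h e)) \<and> all_hit h False ts"
  by (induction F arbitrary: b) auto

lemma all_hit_tokens: "all_hit h False (tokens Fs) \<longleftrightarrow> (\<forall>F \<in> set Fs. \<exists>e \<in> set F. h e)"
  by (induction Fs) (simp_all add: tokens_def all_hit_map_Some)

definition hs_edges :: "nat \<Rightarrow> nat \<Rightarrow> nat option list \<Rightarrow> (nat \<times> nat) list" where
  "hs_edges n d ts = token_edges n (base n) ts @ gadget_edges n d"

text \<open>Every \<open>None\<close> opens a further path, so the tokens of a family leave a lone
  start vertex that is never closed. It is the largest vertex, numbered
  \<open>path_end\<close>.\<close>

definition hs_order :: "nat \<Rightarrow> nat option list \<Rightarrow> nat" where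
  "hs_order n ts = path_end n (base n) ts + 1"

lemma proper_concat [simp]: "proper l (concat ess) \<longleftrightarrow> (\<forall>es \<in> set ess. proper l es)"
  by (auto simp: proper_def)

lemma proper_map [simp]:
  "proper l (map f xs) \<longleftrightarrow> (\<forall>x \<in> set xs. compatible (l (fst (f x))) (l (snd (f x))))"
  by (auto simp: proper_def split_beta)

lemma proper_element_edges:
  "proper l (element_edges n c e) \<longleftrightarrow> (\<forall>j < n.
     compatible (l (c + 2 * j)) (l (c + 2 * j + 1)) \<and>
     compatible (l (c + 2 * j + 1)) (l (c + 2 * j + 2)) \<and>
     compatible (l (c + 2 * j + 1)) (l (switch n e j)) \<and>
     compatible (l (c + 2 * j + 2)) (l (switch n e j)) \<and>
     compatible (l (c + 2 * j + 2)) (l 4))"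
  by (auto simp: element_edges_def)

lemma proper_gadget_edges:
  "proper l (gadget_edges n d) \<longleftrightarrow>
     compatible (l 0) (l 1) \<and> compatible (l 0) (l 4) \<and> compatible (l 1) (l 4) \<and>
     compatible (l 2) (l 3) \<and> compatible (l 2) (l 4) \<and> compatible (l 3) (l 4) \<and>
     compatible (l (base n)) (l 0) \<and> compatible (l (base n)) (l 4) \<and>
     (\<forall>e < n. \<forall>j < n. compatible (l 0) (l (pick n e j)) \<and> compatible (l 1) (l (pick n e j)) \<and>
       compatible (l 2) (l (switch n e j)) \<and> compatible (l 3) (l (switch n e j)) \<and>
       compatible (l (pick n e j)) (l (switch n e j))) \<and>
     (\<forall>e < n. \<forall>f < e. \<forall>j < n. compatible (l (pick n e j)) (l (pick n f j))) \<and>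
     (\<forall>e < n. \<forall>j < d. compatible (l 0) (l (switch n e j)))"
  by (auto simp: gadget_edges_def)

section \<open>Arithmetic of the vertex numbering\<close>

lemma index_less: "e < n \<Longrightarrow> j < n \<Longrightarrow> e * n + j < n * (n :: nat)"
proof -
  assume "e < n" "j < n"
  then have "e * n + j < Suc e * n" by simp
  also have "\<dots> \<le> n * n" using \<open>e < n\<close> by (intro mult_le_mono1) simp
  finally show ?thesis .
qed

lemma switch_less_base: "e < n \<Longrightarrow> j < n \<Longrightarrow> switch n e j < base n"
  using index_less[of e n j] by (simp add: switch_def base_def)

lemma pick_less_switch: "e < n \<Longrightarrow> j < n \<Longrightarrow> pick n e j < 5 + n * n"
  using index_less[of e n j] by (simp add: pick_def)

lemma base_cases:
  assumes "x < base n"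
  obtains "x < 5" | e j where "e < n" "j < n" "x = pick n e j"
  | e j where "e < n" "j < n" "x = switch n e j"
proof -
  have decode: "\<exists>e < n. \<exists>j < n. m = e * n + j" if "m < n * n" for m
  proof -
    have "n > 0" using that by (cases n) auto
    then have "m div n < n" "m mod n < n" using that by (auto simp: less_mult_imp_div_less)
    then show ?thesis by (metis div_mult_mod_eq)
  qed
  consider "x < 5" | "5 \<le> x" "x - 5 < n * n" | "5 + n * n \<le> x" "x - 5 - n * n < n * n"
    using assms by (fastforce simp: base_def)
  then show ?thesis
  proof cases
    case 1
    then show ?thesis by (rule that(1))
  next
    case 2
    from decode[OF 2(2)] 2(1) show ?thesis
      by (metis that(2) pick_def add.assoc le_add_diff_inverse)
  next
    case 3
    from decode[OF 3(2)] obtain e j where "e < n" "j < n" "x - 5 - n * n = e * n + j" by blast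
    then show ?thesis using 3(1) by (intro that(3)[of e j]) (auto simp: switch_def)
  qed
qed

lemma path_end_ge: "c \<le> path_end n c ts"
proof (induction n c ts rule: path_end.induct)
qed auto

text \<open>One slot advances a path by two vertices. The step treats both together, since the label
  of the odd one is controlled by the even ones around it and by the switch.\<close>

lemma path_induct [consumes 1, case_names start step]:
  assumes "i \<le> 2 * (n :: nat)"
    and "P 0"
    and "\<And>j. j < n \<Longrightarrow> P (2 * j) \<Longrightarrow> P (2 * j + 1) \<and> P (2 * j + 2)"
  shows "P i"
proof -
  have even_P: "P (2 * j)" if "j \<le> n" for j
    using that
  proof (induction j)
    case (Suc j)
    with assms(3)[of j] show ?case by simp
  qed (simp add: assms(2))
  show ?thesis
  proof (cases "even i")
    case True
    with even_P[of "i div 2"] assms(1) show ?thesis by simp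
  next
    case False
    then have "i = 2 * (i div 2) + 1" "i div 2 < n" using assms(1) by presburger+
    with even_P[of "i div 2"] assms(3)[of "i div 2"] show ?thesis by (metis less_or_eq_imp_le)
  qed
qed

subsection \<open>Every stable cutset separates 0 from 2\<close>

text \<open>\<open>q\<close>, \<open>p\<close>, \<open>q'\<close> are labels of three consecutive
  path vertices, \<open>v\<close> that of the switch, \<open>s\<close> that of vertex 4. The
  vertices of \<open>p\<close>, \<open>q'\<close> and \<open>v\<close> form a triangle: if
  \<open>v\<close> is \<open>Left\<close>, this settles both; if \<open>v\<close> is
  \<open>Cut\<close>, then \<open>p\<close> and \<open>q'\<close> agree, and they are kept from
  \<open>Right\<close> by \<open>s\<close> when it is \<open>Left\<close> and by \<open>q\<close>
  when \<open>s\<close> is \<open>Cut\<close>.\<close>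

lemma one_sided_step:
  assumes "compatible q p" "compatible p q'" "compatible p v" "compatible q' v" "compatible q' s"
    and "q \<noteq> Right" "s = Cut \<longrightarrow> q = Left" "v \<noteq> Right" "s \<noteq> Right"
  shows "p \<noteq> Right \<and> q' \<noteq> Right \<and> (s = Cut \<longrightarrow> q' = Left)"
proof (cases s)
  case Cut
  then have "p \<noteq> Right" "q' \<noteq> Cut" using assms(1,5,7) by auto
  moreover have "q' \<noteq> Right" using assms(2,3,4,8) \<open>p \<noteq> Right\<close> by (cases p; cases v) auto
  ultimately show ?thesis by (cases q') auto
next
  case Left
  then have "q' \<noteq> Right" using assms(5) by simp
  moreover from this have "p \<noteq> Right" using assms(2,3,4,8) by (cases q'; cases v) auto
  ultimately show ?thesis using Left by simp
qed (use assms in simp)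

text \<open>Used with \<open>s\<close> the label of 4 and with \<open>a\<close>, \<open>b\<close>
  those of the twins 0, 1 or 2, 3. Adjacent twins are not both cut, so anything adjacent to both has
  a neighbour labelled \<open>Left\<close>.\<close>

lemma one_sided_triangle:
  assumes "compatible a b" "compatible a s" "compatible b s" "s = Left \<or> s = Cut \<and> a = Left"
  shows "a \<noteq> Right" "b \<noteq> Right" "a = Left \<or> b = Left"
proof -
  from assms(4) show "a \<noteq> Right" "b \<noteq> Right" using assms(1-3) by auto
  then show "a = Left \<or> b = Left" using assms(1) by (cases a; cases b) auto
qed

text \<open>Each start vertex forms a triangle with 0 and 4 and takes over their side;
  \<open>one_sided_step\<close> carries it along the path. The invariant at even positions is
  stronger when 4 is cut: then the label is exactly \<open>Left\<close>.\<close>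

lemma one_sided_tokens:
  assumes "proper l (token_edges n c ts)" and "\<And>e. Some e \<in> set ts \<Longrightarrow> e < n"
    and "\<And>e j. e < n \<Longrightarrow> j < n \<Longrightarrow> l (switch n e j) \<noteq> Right"
    and "l 4 \<noteq> Right" "l 4 = Cut \<Longrightarrow> l 0 = Left" "l c \<noteq> Right" "l 4 = Cut \<Longrightarrow> l c = Left"
    and "c \<le> x" "x \<le> path_end n c ts"
  shows "l x \<noteq> Right"
  using assms
proof (induction n c ts arbitrary: x rule: token_edges.induct)
  case (1 n c)
  then show ?case by simp
next
  case (2 n c e ts)
  have e: "e < n" using "2.prems"(2) by simp
  have seg: "l (c + i) \<noteq> Right \<and> (even i \<longrightarrow> l 4 = Cut \<longrightarrow> l (c + i) = Left)" if "i \<le> 2 * n" for i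
    using that
  proof (induction i rule: path_induct)
    case start
    show ?case using "2.prems"(6,7) by simp
  next
    case (step j)
    from "2.prems"(1) step(1) have
      "compatible (l (c + 2 * j)) (l (c + 2 * j + 1))"
      "compatible (l (c + 2 * j + 1)) (l (c + 2 * j + 2))"
      "compatible (l (c + 2 * j + 1)) (l (switch n e j))"
      "compatible (l (c + 2 * j + 2)) (l (switch n e j))"
      "compatible (l (c + 2 * j + 2)) (l 4)"
      by (simp_all add: proper_element_edges)
    with step(2) "2.prems"(3)[OF e step(1)] "2.prems"(4) show ?case
      using one_sided_step[of "l (c + 2 * j)" "l (c + 2 * j + 1)" "l (c + 2 * j + 2)"
          "l (switch n e j)" "l 4"] by (simp add: add.assoc)
  qed
  show ?case
  proof (cases "x \<le> c + 2 * n")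
    case True
    then show ?thesis using seg[of "x - c"] "2.prems"(8) by simp
  next
    case False
    show ?thesis
      by (rule "2.IH"[OF _ _ "2.prems"(3-5)])
        (use "2.prems"(1,2,9) seg[of "2 * n"] False in simp_all)
  qed
next
  case (3 n c ts)
  show ?case
  proof (cases "x = c")
    case True
    then show ?thesis using "3.prems"(6) by simp
  next
    case False
    have "compatible (l (c + 1)) (l 0)" "compatible (l (c + 1)) (l 4)" using "3.prems"(1) by simp_all
    then have c: "l (c + 1) \<noteq> Right" "l 4 = Cut \<Longrightarrow> l (c + 1) = Left"
      using "3.prems"(4,5) by (cases "l (c + 1)"; cases "l 4"; cases "l 0"; simp)+
    show ?thesis
      by (rule "3.IH") (use "3.prems" c False in auto)
  qed
qed

definition flip :: "label \<Rightarrow> label" where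
  "flip a = (case a of Left \<Rightarrow> Right | Right \<Rightarrow> Left | Cut \<Rightarrow> Cut)"

lemma flip_simps [simp]: "flip Left = Right" "flip Right = Left" "flip Cut = Cut"
  "flip a = Left \<longleftrightarrow> a = Right" "flip a = Right \<longleftrightarrow> a = Left" "flip a = Cut \<longleftrightarrow> a = Cut"
  by (cases a; simp add: flip_def)+

lemma compatible_flip [simp]: "compatible (flip a) (flip b) \<longleftrightarrow> compatible a b"
  by (cases a; cases b; simp)

lemma proper_flip [simp]: "proper (\<lambda>x. flip (l x)) es \<longleftrightarrow> proper l es"
  by (simp add: proper_def)

text \<open>Triangles and twins tie every vertex to 4 and the terminals. A cutset that leaves 4
  outside, or the terminals 0 and 2 together, thus separates nothing; this excludes all unintended
  cutsets.\<close>

lemma one_sided: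
  assumes proper: "proper l (hs_edges n d ts)" and ts: "\<And>e. Some e \<in> set ts \<Longrightarrow> e < n"
    and "l 4 = Left \<or> l 4 = Cut \<and> l 0 = Left \<and> l 2 = Left"
  shows "Right \<notin> l ` {..<hs_order n ts}"
proof -
  from proper have p: "proper l (token_edges n (base n) ts)" "proper l (gadget_edges n d)"
    by (simp_all add: hs_edges_def)
  note g = p(2)[unfolded proper_gadget_edges]
  have "l 0 \<noteq> Right" "l 1 \<noteq> Right" "l 2 \<noteq> Right" "l 3 \<noteq> Right" "l 4 \<noteq> Right"
    "l 0 = Left \<or> l 1 = Left" "l 2 = Left \<or> l 3 = Left" "l 4 = Cut \<Longrightarrow> l 0 = Left"
    "l (base n) \<noteq> Right" "l 4 = Cut \<Longrightarrow> l (base n) = Left"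
  proof -
    have *: "compatible (l 0) (l 1)" "compatible (l 0) (l 4)" "compatible (l 1) (l 4)"
      "compatible (l 2) (l 3)" "compatible (l 2) (l 4)" "compatible (l 3) (l 4)"
      "compatible (l (base n)) (l 0)" "compatible (l (base n)) (l 4)"
      using g by blast+
    have "l 4 = Left \<or> l 4 = Cut \<and> l 0 = Left" "l 4 = Left \<or> l 4 = Cut \<and> l 2 = Left"
      using assms(3) by blast+
    from one_sided_triangle[OF *(1-3) this(1)] one_sided_triangle[OF *(4-6) this(2)]
    show "l 0 \<noteq> Right" "l 1 \<noteq> Right" "l 2 \<noteq> Right" "l 3 \<noteq> Right"
      "l 0 = Left \<or> l 1 = Left" "l 2 = Left \<or> l 3 = Left"
      by blast+
    show "l 4 \<noteq> Right" "l 4 = Cut \<Longrightarrow> l 0 = Left" using assms(3) by auto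
    show "l (base n) \<noteq> Right" "l 4 = Cut \<Longrightarrow> l (base n) = Left"
      using assms(3) *(7,8) by (cases "l (base n)"; auto)+
  qed
  note small = this
  \<comment> \<open>A neighbour of two twins sees a label \<open>Left\<close>, whichever of the
    twins may be cut.\<close>
  have picks: "l (pick n e j) \<noteq> Right" and switches: "l (switch n e j) \<noteq> Right"
    if "e < n" "j < n" for e j
    using p(2) that small(6,7) unfolding proper_gadget_edges by (metis compatible_simps(3))+
  have "l x \<noteq> Right" if "x < base n" for x
    using that
  proof (cases rule: base_cases)
    case 1
    then have "x \<in> {0, 1, 2, 3, 4}" by auto
    then show ?thesis using small by auto
  qed (use picks switches in auto)
  moreover have "l x \<noteq> Right" if "base n \<le> x" "x < hs_order n ts" for x
    by (rule one_sided_tokens[OF p(1) ts switches])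
      (use small that in \<open>auto simp: hs_order_def\<close>)
  ultimately show ?thesis by (metis imageE lessThan_iff not_le)
qed

text \<open>Swapping the sides preserves properness, so \<open>one_sided\<close> applies to either
  side. What remains is that 4 is cut and that 0 and 2 are apart; a swap, if necessary, puts 0 on
  \<open>Left\<close>.\<close>

lemma separates:
  assumes proper: "proper l (hs_edges n d ts)" and ts: "\<And>e. Some e \<in> set ts \<Longrightarrow> e < n"
    and "Left \<in> l ` {..<hs_order n ts}" "Right \<in> l ` {..<hs_order n ts}"
  obtains l' where "proper l' (hs_edges n d ts)" "l' 0 = Left" "l' 2 = Right" "l' 4 = Cut"
proof -
  have flip: "proper (\<lambda>x. flip (l x)) (hs_edges n d ts)" using proper by simp
  have "Right \<in> (\<lambda>x. flip (l x)) ` {..<hs_order n ts}" using assms(3) by force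
  with one_sided[OF flip ts] have f: "\<not> (flip (l 4) = Left \<or> flip (l 4) = Cut \<and> flip (l 0) = Left \<and> flip (l 2) = Left)"
    by blast
  from one_sided[OF proper ts] assms(4) have "\<not> (l 4 = Left \<or> l 4 = Cut \<and> l 0 = Left \<and> l 2 = Left)"
    by blast
  moreover have "compatible (l 0) (l 4)" "compatible (l 2) (l 4)"
    using proper by (simp_all add: hs_edges_def proper_gadget_edges)
  ultimately have "l 4 = Cut \<and> (l 0 = Left \<and> l 2 = Right \<or> l 0 = Right \<and> l 2 = Left)"
    using f by (cases "l 0"; cases "l 2"; cases "l 4"; simp)
  then show ?thesis using that[of l] that[of "\<lambda>x. flip (l x)"] proper flip by auto
qed

subsection \<open>From stable cutsets to hitting sets\<close>

text \<open>As long as no chosen element is met, the path is stuck at \<open>Left\<close>: a switch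
  in the cutset keeps both of its path neighbours out of it, and adjacent vertices outside the
  cutset agree. The edge from the last vertex to 2 forbids \<open>Left\<close> there.\<close>

lemma all_hit_if_proper:
  assumes "proper l (token_edges n c ts)" and "\<And>e. Some e \<in> set ts \<Longrightarrow> e < n"
    and "\<And>e j. e < n \<Longrightarrow> j < n \<Longrightarrow> l (switch n e j) \<noteq> Left"
    and "l 0 = Left" "l 2 = Right" "l 4 = Cut" "b \<or> l c = Left"
  shows "all_hit (\<lambda>e. \<exists>j < n. l (switch n e j) = Right) b ts"
  using assms
proof (induction n c ts arbitrary: b rule: token_edges.induct)
  case (1 n c)
  then show ?case by simp
next
  case (2 n c e ts)
  let ?h = "\<exists>j < n. l (switch n e j) = Right"
  have "l (c + 2 * n) = Left" if "\<not> (b \<or> ?h)"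
  proof -
    have "even i \<longrightarrow> l (c + i) = Left" if "i \<le> 2 * n" for i
      using that
    proof (induction i rule: path_induct)
      case start
      show ?case using \<open>\<not> (b \<or> ?h)\<close> "2.prems"(7) by simp
    next
      case (step j)
      have "l (switch n e j) = Cut"
        using \<open>\<not> (b \<or> ?h)\<close> step(1) "2.prems"(2,3) by (cases "l (switch n e j)") auto
      moreover from "2.prems"(1) step(1) have
        "compatible (l (c + 2 * j)) (l (c + 2 * j + 1))"
        "compatible (l (c + 2 * j + 1)) (l (c + 2 * j + 2))"
        "compatible (l (c + 2 * j + 1)) (l (switch n e j))"
        "compatible (l (c + 2 * j + 2)) (l (switch n e j))"
        by (simp_all add: proper_element_edges)
      ultimately show ?case using step(2)
        by (cases "l (c + 2 * j + 1)"; cases "l (c + 2 * j + 2)"; simp)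
    qed
    from this[of "2 * n"] show ?thesis by simp
  qed
  then show ?case
    using "2.prems" by (simp, intro "2.IH") auto
next
  case (3 n c ts)
  have "compatible (l c) (l 2)" "compatible (l (c + 1)) (l 0)" "compatible (l (c + 1)) (l 4)"
    using "3.prems"(1) by simp_all
  then have "l c \<noteq> Left" "l (c + 1) = Left"
    using "3.prems"(4-6) by (cases "l (c + 1)"; simp)+
  then show ?case
    using "3.prems" by (simp, intro "3.IH") auto
qed

text \<open>The hitting set consists of the elements with some switch on the side of 2. Its size is
  bounded by an injection into the unblocked slots.\<close>

lemma hitting_set_if_proper:
  assumes proper: "proper l (hs_edges n d ts)" and ts: "\<And>e. Some e \<in> set ts \<Longrightarrow> e < n"
    and l: "l 0 = Left" "l 2 = Right" "l 4 = Cut"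
  shows "\<exists>H \<subseteq> {..<n}. card H \<le> n - d \<and> all_hit (\<lambda>e. e \<in> H) False ts"
proof -
  from proper have p: "proper l (token_edges n (base n) ts)" "proper l (gadget_edges n d)"
    by (simp_all add: hs_edges_def)
  note g = p(2)[unfolded proper_gadget_edges]
  define H where "H = {e. e < n \<and> (\<exists>j < n. l (switch n e j) = Right)}"
  have cutR: "l (switch n e j) \<noteq> Left" if "e < n" "j < n" for e j
    using g that l by auto
  have base: "l (base n) = Left" using g l by (cases "l (base n)") auto
  have "all_hit (\<lambda>e. \<exists>j < n. l (switch n e j) = Right) False ts"
    by (rule all_hit_if_proper[OF p(1) ts cutR]) (use l base in auto)
  moreover have "all_hit (\<lambda>e. \<exists>j < n. l (switch n e j) = Right) False ts
      \<longleftrightarrow> all_hit (\<lambda>e. e \<in> H) False ts"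
    by (rule all_hit_cong) (use ts in \<open>simp add: H_def\<close>)
  ultimately have "all_hit (\<lambda>e. e \<in> H) False ts" by blast
  moreover have "card H \<le> n - d"
  proof -
    \<comment> \<open>An element may occupy several slots; one of them is selected.\<close>
    define s where "s e = (SOME j. j < n \<and> l (switch n e j) = Right)" for e
    have s: "s e < n" "l (switch n e (s e)) = Right" "e < n" if "e \<in> H" for e
      using that someI_ex[of "\<lambda>j. j < n \<and> l (switch n e j) = Right"] by (auto simp: H_def s_def)
    \<comment> \<open>Being adjacent to 0 on one side and to its switch on the other, the vertex can
      only be cut.\<close>
    have pick: "l (pick n e (s e)) = Cut" if "e \<in> H" for e
    proof -
      have "compatible (l 0) (l (pick n e (s e)))"
        "compatible (l (pick n e (s e))) (l (switch n e (s e)))"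
        using g s[OF that] by blast+
      then show ?thesis using l s(2)[OF that] by (cases "l (pick n e (s e))") auto
    qed
    \<comment> \<open>The switches of blocked slots are adjacent to 0 and hence not on the side
      \<open>Right\<close>.\<close>
    have "s e \<ge> d" if "e \<in> H" for e
    proof (rule ccontr)
      assume "\<not> s e \<ge> d"
      then have "compatible (l 0) (l (switch n e (s e)))" using g s[OF that] by auto
      then show False using l s(2)[OF that] by simp
    qed
    then have "s ` H \<subseteq> {d..<n}" using s by auto
    moreover have "inj_on s H"
    proof (rule inj_onI, rule ccontr)
      fix e f assume ef: "e \<in> H" "f \<in> H" "s e = s f" "e \<noteq> f"
      have "compatible (l (pick n a (s a))) (l (pick n b (s a)))" if "a \<in> H" "b < a" for a b
        using g s[OF that(1)] that(2) by blast
      then have "compatible (l (pick n e (s e))) (l (pick n f (s f))) \<or>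
          compatible (l (pick n f (s f))) (l (pick n e (s e)))"
        using ef by (metis linorder_neqE_nat)
      then show False using pick[OF ef(1)] pick[OF ef(2)] by simp
    qed
    ultimately show ?thesis
      by (metis card_inj_on_le card_atLeastLessThan finite_atLeastLessThan)
  qed
  ultimately show ?thesis by (intro exI[of _ H]) (auto simp: H_def)
qed

subsection \<open>From hitting sets to stable cutsets\<close>

lemma extend_labelling:
  assumes "all_hit (\<lambda>e. \<exists>j < n. l0 (switch n e j) = Right) b ts" and "\<And>e. Some e \<in> set ts \<Longrightarrow> e < n"
    and "\<And>e j. e < n \<Longrightarrow> j < n \<Longrightarrow> l0 (switch n e j) \<noteq> Left"
    and "l0 0 = Left" "l0 2 = Right" "l0 4 = Cut"
    and "l0 c = (if b then Right else Left)" "base n \<le> c"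
  shows "\<exists>l. (\<forall>x \<le> c. l x = l0 x) \<and> proper l (token_edges n c ts)"
  using assms
proof (induction n c ts arbitrary: b l0 rule: token_edges.induct)
  case (1 n c)
  then show ?case by auto
next
  case (2 n c e ts)
  have e: "e < n" using "2.prems"(2) by simp
  \<comment> \<open>\<open>Q j\<close> means that a hit occurs before slot \<open>j\<close>. The
    path is \<open>Left\<close> until the first hit, has one cut vertex there, and is
    \<open>Right\<close> afterwards. The cut vertex is at an odd position because the even ones are
    adjacent to 4, which is cut.\<close>
  define Q where "Q j \<longleftrightarrow> b \<or> (\<exists>i < j. l0 (switch n e i) = Right)" for j
  define seg where "seg i = (if Q (i div 2) then Right else if even i then Left
    else if Q (i div 2 + 1) then Cut else Left)" for i
  define l1 where "l1 x = (if x \<le> c \<or> x > c + 2 * n then l0 x else seg (x - c))" for x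
  have switch: "switch n f j \<le> c" if "f < n" "j < n" for f j
    using switch_less_base[OF that] "2.prems"(8) by simp
  have small: "x \<le> c" if "x \<le> 4" for x using that "2.prems"(8) by (simp add: base_def)
  have l1: "l1 (switch n f j) = l0 (switch n f j)" if "f < n" "j < n" for f j
    using switch[OF that] by (simp add: l1_def)
  have hit: "(\<exists>j < n. l1 (switch n f j) = Right) \<longleftrightarrow> (\<exists>j < n. l0 (switch n f j) = Right)" if "f < n" for f
    using l1 that by auto
  have seg: "l1 (c + i) = seg i" if "i \<le> 2 * n" for i
    using that "2.prems"(7) by (cases "i = 0") (auto simp: l1_def seg_def Q_def)
  have "\<exists>l. (\<forall>x \<le> c + 2 * n. l x = l1 x) \<and> proper l (token_edges n (c + 2 * n) ts)"
  proof (rule "2.IH"[where b = "Q n"])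
    have "all_hit (\<lambda>f. \<exists>j < n. l1 (switch n f j) = Right) (Q n) ts
        \<longleftrightarrow> all_hit (\<lambda>f. \<exists>j < n. l0 (switch n f j) = Right) (Q n) ts"
      by (rule all_hit_cong, rule hit) (use "2.prems"(2) in simp)
    then show "all_hit (\<lambda>f. \<exists>j < n. l1 (switch n f j) = Right) (Q n) ts"
      using "2.prems"(1) by (simp add: Q_def)
    show "l1 (c + 2 * n) = (if Q n then Right else Left)"
      using seg[of "2 * n"] by (simp add: seg_def)
  qed (use "2.prems" l1 small in \<open>auto simp: l1_def\<close>)
  then obtain l where l: "\<And>x. x \<le> c + 2 * n \<Longrightarrow> l x = l1 x"
    "proper l (token_edges n (c + 2 * n) ts)" by blast
  have "proper l (element_edges n c e)"
    unfolding proper_element_edges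
  proof (intro allI impI)
    fix j assume j: "j < n"
    have "l (c + 2 * j) = seg (2 * j)" "l (c + 2 * j + 1) = seg (2 * j + 1)"
      "l (c + 2 * j + 2) = seg (2 * j + 2)"
      using j l(1) seg[of "2 * j"] seg[of "2 * j + 1"] seg[of "2 * j + 2"] by simp_all
    moreover have "l (switch n e j) = l0 (switch n e j)" "l 4 = Cut"
      using l(1)[of "switch n e j"] l1[OF e j] switch[OF e j] l(1)[of 4] small[of 4] "2.prems"(6)
      by (auto simp: l1_def)
    moreover have "l0 (switch n e j) \<noteq> Left" using "2.prems"(3)[OF e j] .
    moreover have "Q (j + 1) \<longleftrightarrow> Q j \<or> l0 (switch n e j) = Right"
      by (auto simp: Q_def less_Suc_eq)
    ultimately show "compatible (l (c + 2 * j)) (l (c + 2 * j + 1)) \<and>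
      compatible (l (c + 2 * j + 1)) (l (c + 2 * j + 2)) \<and>
      compatible (l (c + 2 * j + 1)) (l (switch n e j)) \<and>
      compatible (l (c + 2 * j + 2)) (l (switch n e j)) \<and>
      compatible (l (c + 2 * j + 2)) (l 4)"
      by (cases "l0 (switch n e j)") (auto simp: seg_def)
  qed
  then show ?case using l by (intro exI[of _ l]) (auto simp: l1_def)
next
  case (3 n c ts)
  have b: b using "3.prems"(1) by simp
  let ?l1 = "l0(c + 1 := Left)"
  have switch: "switch n f j \<noteq> c + 1" if "f < n" "j < n" for f j
    using switch_less_base[OF that] "3.prems"(8) by simp
  have l1: "?l1 (switch n f j) = l0 (switch n f j)" if "f < n" "j < n" for f j
    using switch[OF that] by simp
  have hit: "(\<exists>j < n. ?l1 (switch n f j) = Right) \<longleftrightarrow> (\<exists>j < n. l0 (switch n f j) = Right)" if "f < n" for f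
    using l1 that by metis
  have small: "x \<le> c" if "x \<le> 4" for x using that "3.prems"(8) by (simp add: base_def)
  have "\<exists>l. (\<forall>x \<le> c + 1. l x = ?l1 x) \<and> proper l (token_edges n (c + 1) ts)"
  proof (rule "3.IH"[where b = False])
    have "all_hit (\<lambda>f. \<exists>j < n. ?l1 (switch n f j) = Right) False ts
        \<longleftrightarrow> all_hit (\<lambda>f. \<exists>j < n. l0 (switch n f j) = Right) False ts"
      by (rule all_hit_cong, rule hit) (use "3.prems"(2) in simp)
    then show "all_hit (\<lambda>f. \<exists>j < n. ?l1 (switch n f j) = Right) False ts"
      using "3.prems"(1) by simp
    show "?l1 (switch n f j) \<noteq> Left" if "f < n" "j < n" for f j
      using "3.prems"(3)[OF that] l1[OF that] by simp
  qed (use "3.prems" small[of 0] small[of 2] small[of 4] in auto)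
  then obtain l where l: "\<And>x. x \<le> c + 1 \<Longrightarrow> l x = ?l1 x"
    "proper l (token_edges n (c + 1) ts)" by blast
  have "l c = Right" "l (c + 1) = Left" "l 0 = Left" "l 2 = Right" "l 4 = Cut"
    using l(1)[of c] l(1)[of "c + 1"] l(1)[of 0] l(1)[of 2] l(1)[of 4] small[of 2] small[of 4]
      "3.prems"(4-7) b by auto
  then show ?case using l by (intro exI[of _ l]) auto
qed

text \<open>The cardinality bound yields an injection of \<open>H\<close> into the unblocked slots.
  It assigns one slot to each element, and injectivity prevents two adjacent \<open>pick\<close>
  vertices from being cut.\<close>

lemma proper_if_hitting_set:
  assumes ts: "\<And>e. Some e \<in> set ts \<Longrightarrow> e < n" and d: "d \<le> n"
    and H: "H \<subseteq> {..<n}" "card H \<le> n - d" "all_hit (\<lambda>e. e \<in> H) False ts"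
  shows "\<exists>l. proper l (hs_edges n d ts) \<and> l 0 = Left \<and> l 2 = Right"
proof -
  have "finite H" using H(1) finite_subset by blast
  moreover have "card H \<le> card {d..<n}" using H(2) by simp
  ultimately obtain g where g: "inj_on g H" "g ` H \<subseteq> {d..<n}"
    by (metis inj_on_iff_card_le finite_atLeastLessThan)
  \<comment> \<open>An offset \<open>m\<close> in a block of \<open>n * n\<close> vertices stands
    for element \<open>m div n\<close> and slot \<open>m mod n\<close>.\<close>
  define chosen where "chosen m \<longleftrightarrow> m div n \<in> H \<and> g (m div n) = m mod n" for m
  define l0 where "l0 x =
    (if x \<le> 1 then Left else if x \<le> 3 then Right else if x = 4 then Cut
     else if x < 5 + n * n then (if chosen (x - 5) then Cut else Left)
     else if x < base n then (if chosen (x - 5 - n * n) then Right else Cut)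
     else Left)" for x
  have chosen: "chosen (e * n + j) \<longleftrightarrow> e \<in> H \<and> g e = j" if "j < n" for e j
    using that by (simp add: chosen_def)
  have pick: "l0 (pick n e j) = (if e \<in> H \<and> g e = j then Cut else Left)" if "e < n" "j < n" for e j
    using pick_less_switch[OF that] chosen[OF that(2), of e] by (simp add: l0_def pick_def)
  have switch: "l0 (switch n e j) = (if e \<in> H \<and> g e = j then Right else Cut)" if "e < n" "j < n" for e j
    using switch_less_base[OF that] chosen[OF that(2), of e] by (simp add: l0_def switch_def)
  have small: "l0 0 = Left" "l0 1 = Left" "l0 2 = Right" "l0 3 = Right" "l0 4 = Cut"
    "l0 (base n) = Left"
    by (simp_all add: l0_def base_def)
  have hit: "(\<exists>j < n. l0 (switch n e j) = Right) \<longleftrightarrow> e \<in> H" if "e < n" for e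
    using switch[OF that] g by (auto simp: image_subset_iff split: if_splits)
  have "all_hit (\<lambda>e. \<exists>j < n. l0 (switch n e j) = Right) False ts
      \<longleftrightarrow> all_hit (\<lambda>e. e \<in> H) False ts"
    by (rule all_hit_cong) (use hit ts in blast)
  with H(3) have "all_hit (\<lambda>e. \<exists>j < n. l0 (switch n e j) = Right) False ts" by blast
  then have "\<exists>l. (\<forall>x \<le> base n. l x = l0 x) \<and> proper l (token_edges n (base n) ts)"
    by (rule extend_labelling) (use ts small switch in auto)
  then obtain l where l: "\<And>x. x \<le> base n \<Longrightarrow> l x = l0 x" "proper l (token_edges n (base n) ts)"
    by blast
  have l': "l (pick n e j) = l0 (pick n e j)" "l (switch n e j) = l0 (switch n e j)"
    if "e < n" "j < n" for e j
    using l(1) pick_less_switch[OF that] switch_less_base[OF that] by (auto simp: base_def)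
  have lsmall: "l 0 = Left" "l 1 = Left" "l 2 = Right" "l 3 = Right" "l 4 = Cut" "l (base n) = Left"
    using small l(1) by (simp_all add: base_def)
  have "proper l (gadget_edges n d)"
    unfolding proper_gadget_edges
  proof (intro conjI allI impI)
    fix e f j assume e: "e < n" "f < e" and j: "j < n"
    have "\<not> (e \<in> H \<and> g e = j \<and> f \<in> H \<and> g f = j)"
      using g(1) e(2) by (metis inj_onD less_irrefl)
    then show "compatible (l (pick n e j)) (l (pick n f j))"
      using e j by (auto simp: l' pick)
  next
    fix e j assume e: "e < n" and j: "j < d"
    have "\<not> (e \<in> H \<and> g e = j)" using g(2) j by fastforce
    then show "compatible (l 0) (l (switch n e j))"
      using e j d by (simp add: l' switch lsmall)
  qed (auto simp: l' pick switch lsmall lsmall(2)[unfolded One_nat_def])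
  with l(2) lsmall show ?thesis by (auto simp: hs_edges_def)
qed

subsection \<open>Correctness of the construction\<close>

lemma token_edges_less:
  assumes "\<And>e. Some e \<in> set ts \<Longrightarrow> e < n" "base n \<le> c" "(u, v) \<in> set (token_edges n c ts)"
  shows "u \<le> path_end n c ts \<and> v \<le> path_end n c ts \<and> u \<noteq> v"
  using assms
proof (induction n c ts rule: token_edges.induct)
  case (2 n c e ts)
  note ge = path_end_ge[of "c + 2 * n" n ts]
  show ?case
  proof (cases "(u, v) \<in> set (element_edges n c e)")
    case True
    then obtain j where "j < n" and uv: "(u, v) \<in> {(c + 2 * j, c + 2 * j + 1),
        (c + 2 * j + 1, c + 2 * j + 2), (c + 2 * j + 1, switch n e j),
        (c + 2 * j + 2, switch n e j), (c + 2 * j + 2, 4)}"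
      by (auto simp: element_edges_def)
    have "switch n e j < c" using switch_less_base[of e n j] "2.prems" \<open>j < n\<close> by simp
    moreover have "4 < c" using "2.prems"(2) by (simp add: base_def)
    ultimately show ?thesis using uv ge \<open>j < n\<close> by auto
  next
    case False
    then show ?thesis using 2 by auto
  qed
next
  case (3 n c ts)
  then show ?case using path_end_ge[of "c + 1" n ts] by (auto simp: base_def)
qed auto

lemma gadget_edges_cases:
  assumes "(u, v) \<in> set (gadget_edges n d)"
  obtains "(u, v) \<in> {(0, 1), (0, 4), (1, 4), (2, 3), (2, 4), (3, 4), (base n, 0), (base n, 4)}"
  | e j where "e < n" "j < n" "(u, v) \<in> {(0, pick n e j), (1, pick n e j), (2, switch n e j),
      (3, switch n e j), (pick n e j, switch n e j)}"
  | e f j where "e < n" "f < e" "j < n" "(u, v) = (pick n e j, pick n f j)"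
  | e j where "e < n" "j < d" "(u, v) = (0, switch n e j)"
proof -
  have image: "(u, v) \<in> (\<lambda>x. (f x, g x)) ` A \<longleftrightarrow> (\<exists>x \<in> A. u = f x \<and> v = g x)"
    for f g :: "nat \<Rightarrow> nat" and A
    by auto
  from assms have "(u, v) \<in> {(0, 1), (0, 4), (1, 4), (2, 3), (2, 4), (3, 4), (base n, 0), (base n, 4)} \<or>
    (\<exists>e < n. \<exists>j < n. (u, v) \<in> {(0, pick n e j), (1, pick n e j), (2, switch n e j),
      (3, switch n e j), (pick n e j, switch n e j)}) \<or>
    (\<exists>e < n. \<exists>f < e. \<exists>j < n. (u, v) = (pick n e j, pick n f j)) \<or>
    u = 0 \<and> (\<exists>e < n. \<exists>j < d. v = switch n e j)"
    by (simp add: gadget_edges_def image Bex_def)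
  then show ?thesis
  proof (elim disjE)
    assume "(u, v) \<in> {(0, 1), (0, 4), (1, 4), (2, 3), (2, 4), (3, 4), (base n, 0), (base n, 4)}"
    then show ?thesis by (rule that(1))
  next
    assume "\<exists>e < n. \<exists>j < n. (u, v) \<in> {(0, pick n e j), (1, pick n e j), (2, switch n e j),
      (3, switch n e j), (pick n e j, switch n e j)}"
    then show ?thesis by (elim exE conjE) (rule that(2))
  next
    assume "\<exists>e < n. \<exists>f < e. \<exists>j < n. (u, v) = (pick n e j, pick n f j)"
    then show ?thesis by (elim exE conjE) (rule that(3))
  next
    assume "u = 0 \<and> (\<exists>e < n. \<exists>j < d. v = switch n e j)"
    then show ?thesis by (elim exE conjE) (rule that(4), auto)
  qed
qed

lemma gadget_edges_less:
  assumes "(u, v) \<in> set (gadget_edges n d)" "d \<le> n"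
  shows "u \<le> base n \<and> v \<le> base n \<and> u \<noteq> v"
proof -
  have lt: "pick n e j \<le> base n \<and> switch n e j \<le> base n \<and> pick n e j < switch n e j \<and> 5 \<le> pick n e j"
    if "e < n" "j < n" for e j
    using pick_less_switch[OF that] switch_less_base[OF that] that
    by (simp add: base_def pick_def switch_def)
  have neq: "pick n e j \<noteq> pick n f j" if "f < e" "e < n" for e f j
    using that by (simp add: pick_def)
  from assms(1) show ?thesis
  proof (cases rule: gadget_edges_cases)
    case 1
    then show ?thesis by (auto simp: base_def)
  next
    case (2 e j)
    then show ?thesis using lt[OF 2(1,2)] by auto
  next
    case (3 e f j)
    then show ?thesis using lt[of e j] lt[of f j] neq[of f e j] by auto
  next
    case (4 e j)
    then show ?thesis using lt[of e j] assms(2) by auto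
  qed
qed

lemma simple_graph_hs:
  assumes "\<And>e. Some e \<in> set ts \<Longrightarrow> e < n" "d \<le> n"
  shows "simple_graph (graph_of (hs_order n ts) (hs_edges n d ts))"
  using token_edges_less[OF assms(1)] gadget_edges_less[OF _ assms(2)] path_end_ge[of "base n" n ts]
  by (fastforce simp: simple_graph_of hs_order_def hs_edges_def)

section \<open>The graph without the modulator as a union of paths\<close>

fun token_paths :: "nat \<Rightarrow> nat \<Rightarrow> nat \<Rightarrow> nat option list \<Rightarrow> nat list list" where
  "token_paths n b c [] = [[b..<c + 1]]"
| "token_paths n b c (Some e # ts) = token_paths n b (c + 2 * n) ts"
| "token_paths n b c (None # ts) = [b..<c + 1] # token_paths n (c + 1) (c + 1) ts"

lemma concat_token_paths:
  "b \<le> c \<Longrightarrow> concat (token_paths n b c ts) = [b..<path_end n c ts + 1] \<and> [] \<notin> set (token_paths n b c ts)"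
proof (induction n b c ts rule: token_paths.induct)
  case (3 n b c ts)
  then show ?case
    using path_end_ge[of "c + 1" n ts] upt_add_eq_append[of b "c + 1" "path_end n (c + 1) ts - c"]
    by auto
qed auto

lemma path_edges_upt: "path_edges [b..<Suc c] = {{x, Suc x} | x. b \<le> x \<and> x < c}"
proof (intro set_eqI iffI)
  fix E assume "E \<in> path_edges [b..<Suc c]"
  then obtain i where "Suc i < Suc c - b" "E = {[b..<Suc c] ! i, [b..<Suc c] ! Suc i}"
    by (auto simp: path_edges_def simp del: upt_Suc)
  then have "E = {b + i, Suc (b + i)}" "b + i < c" by (simp_all del: upt_Suc)
  then show "E \<in> {{x, Suc x} | x. b \<le> x \<and> x < c}" by (intro CollectI exI[of _ "b + i"]) simp
next
  fix E assume "E \<in> {{x, Suc x} | x. b \<le> x \<and> x < c}"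
  then obtain x where x: "E = {x, Suc x}" "b \<le> x" "x < c" by blast
  then have "E = {[b..<Suc c] ! (x - b), [b..<Suc c] ! Suc (x - b)}" "Suc (x - b) < length [b..<Suc c]"
    by (simp_all del: upt_Suc)
  then show "E \<in> path_edges [b..<Suc c]" unfolding path_edges_def by blast
qed

text \<open>Edges to a switch or to 4 have an end in the modulator. What survives are the two path
  edges of each slot.\<close>

lemma element_edges_forest:
  assumes "e < n" "base n \<le> c"
  shows "{{u, v} | u v. (u, v) \<in> set (element_edges n c e) \<and> {u, v} \<inter> {..<base n} = {}}
     = {{x, x + 1} | x. c \<le> x \<and> x < c + 2 * n}" (is "?L = ?R")
proof
  show "?L \<subseteq> ?R"
  proof
    fix E assume "E \<in> ?L"
    then obtain u v where E: "E = {u, v}" "(u, v) \<in> set (element_edges n c e)" "v \<ge> base n"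
      by auto
    then obtain j where "j < n" and uv: "(u, v) \<in> {(c + 2 * j, c + 2 * j + 1),
        (c + 2 * j + 1, c + 2 * j + 2), (c + 2 * j + 1, switch n e j),
        (c + 2 * j + 2, switch n e j), (c + 2 * j + 2, 4)}"
      by (auto simp: element_edges_def)
    moreover have "switch n e j < base n" "4 < base n"
      using switch_less_base[OF assms(1) \<open>j < n\<close>] by (simp_all add: base_def)
    ultimately have "v = u + 1 \<and> c \<le> u \<and> u < c + 2 * n" using E(3) by auto
    with E(1) show "E \<in> ?R" by blast
  qed
  show "?R \<subseteq> ?L"
  proof
    fix E assume "E \<in> ?R"
    then obtain x where x: "E = {x, x + 1}" "c \<le> x" "x < c + 2 * n" by blast
    define j where "j = (x - c) div 2"
    have "j < n" "x = c + 2 * j \<or> x = c + 2 * j + 1" using x(2,3) unfolding j_def by presburger+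
    then have "(x, x + 1) \<in> set (element_edges n c e)" by (auto simp: element_edges_def)
    moreover have "{x, x + 1} \<inter> {..<base n} = {}" using x(2) assms(2) by auto
    ultimately show "E \<in> ?L" using x(1) by blast
  qed
qed

text \<open>A path spans several tokens, so the claim is generalised by the piece from
  \<open>b\<close> to \<open>c\<close> of the current path, whose edges belong to tokens already
  consumed.\<close>

lemma token_paths_edges:
  assumes "\<And>e. Some e \<in> set ts \<Longrightarrow> e < n" "base n \<le> b" "b \<le> c"
  shows "(\<Union>p \<in> set (token_paths n b c ts). path_edges p) = {{x, x + 1} | x. b \<le> x \<and> x < c} \<union>
    {{u, v} | u v. (u, v) \<in> set (token_edges n c ts) \<and> {u, v} \<inter> {..<base n} = {}}"
  using assms
proof (induction n b c ts rule: token_paths.induct)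
  case (1 n b c)
  then show ?case by (simp add: path_edges_upt del: upt_Suc)
next
  case (2 n b c e ts)
  have "{{u, v} | u v. (u, v) \<in> set (token_edges n c (Some e # ts)) \<and> {u, v} \<inter> {..<base n} = {}}
    = {{u, v} | u v. (u, v) \<in> set (element_edges n c e) \<and> {u, v} \<inter> {..<base n} = {}} \<union>
      {{u, v} | u v. (u, v) \<in> set (token_edges n (c + 2 * n) ts) \<and> {u, v} \<inter> {..<base n} = {}}"
    by auto
  also have "{{u, v} | u v. (u, v) \<in> set (element_edges n c e) \<and> {u, v} \<inter> {..<base n} = {}}
    = {{x, x + 1} | x. c \<le> x \<and> x < c + 2 * n}"
    by (rule element_edges_forest) (use "2.prems" in auto)
  finally have *: "{{u, v} | u v. (u, v) \<in> set (token_edges n c (Some e # ts)) \<and> {u, v} \<inter> {..<base n} = {}}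
    = {{x, x + 1} | x. c \<le> x \<and> x < c + 2 * n} \<union>
      {{u, v} | u v. (u, v) \<in> set (token_edges n (c + 2 * n) ts) \<and> {u, v} \<inter> {..<base n} = {}}" .
  have "{{x, x + 1} | x. b \<le> x \<and> x < c + 2 * n} =
      {{x, x + 1} | x. b \<le> x \<and> x < c} \<union> {{x, x + 1} | x. c \<le> x \<and> x < c + 2 * n}"
    using "2.prems"(3) by (auto simp: Un_def) (metis not_le)
  with * "2.IH" "2.prems" show ?case by auto
next
  case (3 n b c ts)
  have "{{u, v} | u v. (u, v) \<in> set (token_edges n c (None # ts)) \<and> {u, v} \<inter> {..<base n} = {}}
    = {{u, v} | u v. (u, v) \<in> set (token_edges n (c + 1) ts) \<and> {u, v} \<inter> {..<base n} = {}}"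
    by (auto simp: base_def)
  with 3 show ?case by (auto simp: path_edges_upt simp del: upt_Suc)
qed

lemma linear_forest_hs:
  assumes "\<And>e. Some e \<in> set ts \<Longrightarrow> e < n" "d \<le> n"
  shows "linear_forest (delete_vertices (graph_of (hs_order n ts) (hs_edges n d ts)) {..<base n})"
proof -
  let ?ps = "token_paths n (base n) (base n) ts"
  have c: "concat ?ps = [base n..<path_end n (base n) ts + 1]" "[] \<notin> set ?ps"
    using concat_token_paths[of "base n" "base n" n ts] by auto
  have "u < base n \<or> v < base n" if "(u, v) \<in> set (gadget_edges n d)" for u v
    using that
  proof (cases rule: gadget_edges_cases)
    case (2 e j)
    then show ?thesis using pick_less_switch[OF 2(1,2)] switch_less_base[OF 2(1,2)] by (auto simp: base_def)
  next
    case (3 e f j)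
    then show ?thesis using pick_less_switch[of e n j] by (auto simp: base_def)
  qed (auto simp: base_def)
  then have "{e \<in> {{u, v} | u v. (u, v) \<in> set (hs_edges n d ts)}. e \<inter> {..<base n} = {}}
     = {{u, v} | u v. (u, v) \<in> set (token_edges n (base n) ts) \<and> {u, v} \<inter> {..<base n} = {}}"
    by (fastforce simp: hs_edges_def)
  \<comment> \<open>Initially \<open>b = c\<close>, and the piece already traversed has no
    edges.\<close>
  also have "\<dots> = {{x, x + 1} | x. base n \<le> x \<and> x < base n} \<union> \<dots>" by auto
  also have "\<dots> = (\<Union>p \<in> set ?ps. path_edges p)"
    by (rule token_paths_edges[symmetric]) (use assms(1) in auto)
  finally have edges: "{e \<in> {{u, v} | u v. (u, v) \<in> set (hs_edges n d ts)}. e \<inter> {..<base n} = {}}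
     = (\<Union>p \<in> set ?ps. path_edges p)" .
  have "{..<hs_order n ts} - {..<base n} = set (concat ?ps)"
    unfolding c(1) by (auto simp: hs_order_def)
  moreover have "distinct (concat ?ps)" unfolding c(1) by simp
  ultimately show ?thesis
    unfolding linear_forest_def delete_vertices_def graph_of_def split_conv edges
    using c(2) by (intro exI[of _ ?ps] conjI) auto
qed

lemma stable_cutset_hs:
  assumes ts: "\<And>e. Some e \<in> set ts \<Longrightarrow> e < n" and d: "d \<le> n"
  shows "(\<exists>S. stable_cutset (graph_of (hs_order n ts) (hs_edges n d ts)) S) \<longleftrightarrow>
    (\<exists>H \<subseteq> {..<n}. card H \<le> n - d \<and> all_hit (\<lambda>e. e \<in> H) False ts)"
proof
  assume "\<exists>S. stable_cutset (graph_of (hs_order n ts) (hs_edges n d ts)) S"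
  then obtain l where "proper l (hs_edges n d ts)"
      "Left \<in> l ` {..<hs_order n ts}" "Right \<in> l ` {..<hs_order n ts}"
    using stable_cutset_iff_labelling[OF simple_graph_hs[OF ts d]] by blast
  from separates[OF this(1) ts this(2,3)]
  obtain l' where "proper l' (hs_edges n d ts)" "l' 0 = Left" "l' 2 = Right" "l' 4 = Cut"
    by metis
  from hitting_set_if_proper[OF this(1) ts this(2-4)]
  show "\<exists>H \<subseteq> {..<n}. card H \<le> n - d \<and> all_hit (\<lambda>e. e \<in> H) False ts" by blast
next
  assume "\<exists>H \<subseteq> {..<n}. card H \<le> n - d \<and> all_hit (\<lambda>e. e \<in> H) False ts"
  then obtain l where l: "proper l (hs_edges n d ts)" "l 0 = Left" "l 2 = Right"
    using proper_if_hitting_set[OF ts d] by metis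
  have "2 < hs_order n ts" using path_end_ge[of "base n" n ts] by (simp add: hs_order_def base_def)
  then have "Left \<in> l ` {..<hs_order n ts}" "Right \<in> l ` {..<hs_order n ts}"
    using l(2,3) imageI[of 0 "{..<hs_order n ts}" l] imageI[of 2 "{..<hs_order n ts}" l] by simp_all
  with l(1) show "\<exists>S. stable_cutset (graph_of (hs_order n ts) (hs_edges n d ts)) S"
    using stable_cutset_iff_labelling[OF simple_graph_hs[OF ts d]] by blast
qed

section \<open>The reduction as a program\<close>

text \<open>
  Registers: 1 universe size \<open>n\<close>, 4 current path vertex, 5 how much the current element may still grow
  (initially \<open>n\<close>, used to compare the first number with the parameter), 6 number of blocked slots,
  7 current element, 8 and 9 flags for the two numbers of the header having been read,
  10 flag for an unfinished set. Malformed input is answered by the loop \<open>(0, 0)\<close>, which no simple graph has.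
\<close>

declare One_nat_def [simp del]

text \<open>With explicit register contents, \<open>run\<close> can be evaluated by rewriting.
  Registers that are not listed are 0, as the time bounds demand from 11 on.\<close>

definition regs :: "nat \<Rightarrow> nat \<Rightarrow> nat \<Rightarrow> nat \<Rightarrow> nat \<Rightarrow> nat \<Rightarrow> nat \<Rightarrow> nat \<Rightarrow> stack \<Rightarrow> nat" where
  "regs n c m d e f1 f2 f3 =
    (\<lambda>_. 0)(1 := n, 4 := c, 5 := m, 6 := d, 7 := e, 8 := f1, 9 := f2, 10 := f3)"

lemma regs_apply [simp]:
  "regs n c m d e f1 f2 f3 1 = n" "regs n c m d e f1 f2 f3 4 = c" "regs n c m d e f1 f2 f3 5 = m"
  "regs n c m d e f1 f2 f3 6 = d" "regs n c m d e f1 f2 f3 7 = e" "regs n c m d e f1 f2 f3 8 = f1"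
  "regs n c m d e f1 f2 f3 9 = f2" "regs n c m d e f1 f2 f3 10 = f3"
  by (simp_all add: regs_def)

lemma regs_update [simp]:
  "(regs n c m d e f1 f2 f3)(1 := x) = regs x c m d e f1 f2 f3"
  "(regs n c m d e f1 f2 f3)(4 := x) = regs n x m d e f1 f2 f3"
  "(regs n c m d e f1 f2 f3)(5 := x) = regs n c x d e f1 f2 f3"
  "(regs n c m d e f1 f2 f3)(6 := x) = regs n c m x e f1 f2 f3"
  "(regs n c m d e f1 f2 f3)(7 := x) = regs n c m d x f1 f2 f3"
  "(regs n c m d e f1 f2 f3)(8 := x) = regs n c m d e x f2 f3"
  "(regs n c m d e f1 f2 f3)(9 := x) = regs n c m d e f1 x f3"
  "(regs n c m d e f1 f2 f3)(10 := x) = regs n c m d e f1 f2 x"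
  by (simp_all add: regs_def fun_eq_iff)

lemma regs_le:
  assumes "n \<le> B" "c \<le> B" "m \<le> B" "d \<le> B" "e \<le> B" "f1 \<le> B" "f2 \<le> B" "f3 \<le> B"
  shows "regs n c m d e f1 f2 f3 r \<le> B"
  using assms by (simp add: regs_def)

lemma regs_eq_0: "11 \<le> r \<Longrightarrow> regs n c m d e f1 f2 f3 r = 0"
  by (simp add: regs_def)

section \<open>The edge lists as loop programs\<close>

definition base_expr :: expr where
  "base_expr = Plus (Const 5) (Times (Const 2) (Times (Var 1) (Var 1)))"

definition pick_expr :: "expr \<Rightarrow> expr \<Rightarrow> expr" where
  "pick_expr e j = Plus (Const 5) (Plus (Times e (Var 1)) j)"

definition switch_expr :: "expr \<Rightarrow> expr \<Rightarrow> expr" where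
  "switch_expr e j = Plus (Plus (Const 5) (Times (Var 1) (Var 1))) (Plus (Times e (Var 1)) j)"

definition q_expr :: "nat \<Rightarrow> expr" where
  "q_expr i = Plus (Plus (Var 4) (Times (Const 2) (Var 11))) (Const i)"

fun edge_seq :: "edge_list \<Rightarrow> edge_list list \<Rightarrow> edge_list" where
  "edge_seq c [] = c"
| "edge_seq c (d # ds) = Both c (edge_seq d ds)"

definition element_prog :: edge_list where
  "element_prog = For 11 (Var 1) (edge_seq (Edge (q_expr 0) (q_expr 1))
    [Edge (q_expr 1) (q_expr 2), Edge (q_expr 1) (switch_expr (Var 7) (Var 11)),
     Edge (q_expr 2) (switch_expr (Var 7) (Var 11)), Edge (q_expr 2) (Const 4)])"

definition close_prog :: edge_list where
  "close_prog = edge_seq (Edge (Var 4) (Const 2))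
    [Edge (Plus (Var 4) (Const 1)) (Const 0), Edge (Plus (Var 4) (Const 1)) (Const 4)]"

definition gadget_prog :: edge_list where
  "gadget_prog = edge_seq (Edge (Const 0) (Const 1))
    [Edge (Const 0) (Const 4), Edge (Const 1) (Const 4), Edge (Const 2) (Const 3),
     Edge (Const 2) (Const 4), Edge (Const 3) (Const 4), Edge base_expr (Const 0), Edge base_expr (Const 4),
     For 11 (Var 1) (For 12 (Var 1) (edge_seq (Edge (Const 0) (pick_expr (Var 11) (Var 12)))
       [Edge (Const 1) (pick_expr (Var 11) (Var 12)), Edge (Const 2) (switch_expr (Var 11) (Var 12)),
        Edge (Const 3) (switch_expr (Var 11) (Var 12)),
        Edge (pick_expr (Var 11) (Var 12)) (switch_expr (Var 11) (Var 12))])),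
     For 11 (Var 1) (For 12 (Var 11) (For 13 (Var 1)
       (Edge (pick_expr (Var 11) (Var 13)) (pick_expr (Var 12) (Var 13))))),
     For 11 (Var 1) (For 12 (Var 6) (Edge (Const 0) (switch_expr (Var 11) (Var 12))))]"

text \<open>Listing every modulator vertex twice makes the list of modulator vertices a list of pairs.\<close>

definition modulator_prog :: edge_list where
  "modulator_prog = For 11 base_expr (Edge (Var 11) (Var 11))"

lemmas prog_defs = element_prog_def close_prog_def gadget_prog_def modulator_prog_def
  base_expr_def pick_expr_def switch_expr_def q_expr_def

lemma edges_element_prog:
  "edges element_prog (regs n c m d e f1 f2 f3) = element_edges n c e"
  by (simp add: prog_defs element_edges_def switch_def add.assoc)

lemma edges_close_prog:
  "edges close_prog (regs n c m d e f1 f2 f3) = [(c, 2), (c + 1, 0), (c + 1, 4)]"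
  by (simp add: prog_defs)

text \<open>The lists agree including their order: \<open>gadget_edges\<close> runs through reversed
  ranges because the loops count down.\<close>

lemma edges_gadget_prog:
  "edges gadget_prog (regs n c m d e f1 f2 f3) = gadget_edges n d"
  by (simp add: prog_defs gadget_edges_def switch_def pick_def base_def add.assoc mult.assoc)

lemma edges_modulator_prog:
  "edges modulator_prog (regs n c m d e f1 f2 f3) = map (\<lambda>i. (i, i)) (rev [0..<base n])"
  by (simp add: prog_defs base_def mult.assoc)

definition fail :: statement where
  "fail = Edges (Edge (Const 0) (Const 0))"

definition skip :: statement where
  "skip = AddTo 4 (Const 0)"

definition assign :: "stack \<Rightarrow> expr \<Rightarrow> statement" where
  "assign r e = Clear r ;; AddTo r e"

definition start_prog :: statement where
  "start_prog = AddTo 4 base_expr ;; AddTo 5 (Var 1) ;; AddTo 6 (Var 1)"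

text \<open>Register 5 is tested in opposite ways. It must be 0 when the first number ends, which
  then equals the parameter, and positive when an element ends, which is then below
  \<open>n\<close>. A failure only leaves its mark among the edges; reading goes on.\<close>

definition symbol_prog :: "symbol \<Rightarrow> statement" where
  "symbol_prog a =
    (if a = 0 then
       If0 8 (If0 5 fail (Dec 5)) (If0 9 (Dec 6)
         (assign 10 (Const 1) ;; AddTo 7 (Const 1) ;; If0 5 fail (Dec 5)))
     else if a = 1 then
       If0 8 (If0 5 skip fail ;; AddTo 8 (Const 1) ;; assign 5 (Var 1))
         (If0 9 (AddTo 9 (Const 1))
           (assign 10 (Const 1) ;; If0 5 fail skip ;; Edges element_prog ;;
            AddTo 4 (Times (Const 2) (Var 1)) ;; Clear 7 ;; assign 5 (Var 1)))
     else
       If0 9 fail (If0 7 skip fail ;; Edges close_prog ;; AddTo 4 (Const 1) ;; Clear 10))"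

text \<open>The two tests demand a complete header and a closed last set. The new parameter depends
  on register 1, which \<open>assign\<close> clears before evaluating, so it is computed in register
  5 and then transferred.\<close>

definition finish_prog :: statement where
  "finish_prog = If0 9 fail skip ;; If0 10 skip fail ;; Edges gadget_prog ;; Symbol 2 ;;
    Edges modulator_prog ;; Symbol 2 ;; assign 5 base_expr ;; assign 1 (Var 5)"

lemma wf_progs: "wf_statement start_prog" "wf_statement (symbol_prog a)" "wf_statement finish_prog"
  by (auto simp: start_prog_def symbol_prog_def finish_prog_def fail_def skip_def assign_def prog_defs)

lemma run_skip [simp]: "run skip \<sigma> = \<sigma>"
  by (simp add: skip_def)

lemma run_fail [simp]: "run fail (\<rho>, out) = (\<rho>, out @ encode_edges [(0, 0)])"
  by (simp add: fail_def)

lemma run_symbol_prog: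
  "run (symbol_prog 0) (regs n c m d e 0 0 f3, out) =
    (regs n c (m - 1) d e 0 0 f3, out @ encode_edges (if m = 0 then [(0, 0)] else []))"
  "run (symbol_prog 0) (regs n c m d e 1 0 f3, out) = (regs n c m (d - 1) e 1 0 f3, out)"
  "run (symbol_prog 0) (regs n c m d e 1 1 f3, out) =
    (regs n c (m - 1) d (e + 1) 1 1 1, out @ encode_edges (if m = 0 then [(0, 0)] else []))"
  "run (symbol_prog 1) (regs n c m d e 0 0 f3, out) =
    (regs n c n d e 1 0 f3, out @ encode_edges (if m = 0 then [] else [(0, 0)]))"
  "run (symbol_prog 1) (regs n c m d e 1 0 f3, out) = (regs n c m d e 1 1 f3, out)"
  "run (symbol_prog 1) (regs n c m d e 1 1 f3, out) =
    (regs n (c + 2 * n) n d 0 1 1 1,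
     out @ encode_edges ((if m = 0 then [(0, 0)] else []) @ element_edges n c e))"
  "run (symbol_prog 2) (regs n c m d e f1 0 f3, out) =
    (regs n c m d e f1 0 f3, out @ encode_edges [(0, 0)])"
  "run (symbol_prog 2) (regs n c m d e f1 1 f3, out) =
    (regs n (c + 1) m d e f1 1 0,
     out @ encode_edges ((if e = 0 then [] else [(0, 0)]) @ [(c, 2), (c + 1, 0), (c + 1, 4)]))"
  by (simp_all add: symbol_prog_def assign_def edges_element_prog edges_close_prog add.commute)

lemma run_finish_prog:
  "run finish_prog (regs n c m d e f1 f2 f3, encode_edges es) =
    (regs (base n) c (base n) d e f1 f2 f3,
     encode_edges (es @ (if f2 = 0 then [(0, 0)] else []) @ (if f3 = 0 then [] else [(0, 0)]) @
       gadget_edges n d) @ [2] @ encode_edges (map (\<lambda>i. (i, i)) (rev [0..<base n])) @ [2])"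
  by (simp add: finish_prog_def assign_def edges_gadget_prog edges_modulator_prog)
    (simp add: base_expr_def base_def mult.assoc)

definition start_config :: "nat \<Rightarrow> (stack \<Rightarrow> nat) \<times> symbol list" where
  "start_config n = (regs n (base n) n n 0 0 0 0, [])"

definition read :: "symbol list \<Rightarrow> (stack \<Rightarrow> nat) \<times> symbol list \<Rightarrow> (stack \<Rightarrow> nat) \<times> symbol list" where
  "read x \<sigma> = fold (\<lambda>a. run (symbol_prog a)) x \<sigma>"

lemma read_simps [simp]:
  "read [] \<sigma> = \<sigma>" "read (a # x) \<sigma> = read x (run (symbol_prog a) \<sigma>)" "read (x @ y) \<sigma> = read y (read x \<sigma>)"
  by (simp_all add: read_def)

subsection \<open>Well-formed input\<close>

text \<open>Truncated subtraction caps the budget: tally marks beyond \<open>n\<close> leave the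
  number of blocked slots at 0.\<close>

lemma read_header:
  "read (encode_nat n @ encode_nat k) (start_config n) = (regs n (base n) n (n - k) 0 1 1 0, [])"
proof -
  have 1: "read (replicate i 0) (regs n c m d 0 0 0 0, []) = (regs n c (m - i) d 0 0 0 0, [])"
    if "i \<le> m" for c i m d
    using that by (induction i arbitrary: m) (auto simp: run_symbol_prog plus_1_eq_Suc)
  have 2: "read (replicate i 0) (regs n c m d 0 1 0 0, []) = (regs n c m (d - i) 0 1 0 0, [])"
    for c i m d
    by (induction i arbitrary: d) (auto simp: run_symbol_prog plus_1_eq_Suc)
  show ?thesis
    by (simp add: encode_nat_def start_config_def 1 2 run_symbol_prog(4,5))
qed

lemma read_element:
  assumes "e < n"
  shows "read (encode_nat e) (regs n c n d 0 1 1 f3, out) =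
    (regs n (c + 2 * n) n d 0 1 1 1, out @ encode_edges (element_edges n c e))"
proof -
  have "read (replicate i 0) (regs n c m d a 1 1 f3, out) =
      (regs n c (m - i) d (a + i) 1 1 (if i = 0 then f3 else 1), out)"
    if "i \<le> m" for i m a f3
    using that by (induction i arbitrary: m a f3)
      (auto simp: run_symbol_prog plus_1_eq_Suc simp flip: Suc_eq_plus1)
  from this[of e n 0 f3] assms show ?thesis
    by (simp add: encode_nat_def run_symbol_prog(6))
qed

lemma read_set:
  assumes "set F \<subseteq> {..<n}"
  shows "read (encode_nats F) (regs n c n d 0 1 1 f3, out) =
    (regs n (path_end n c (map Some F @ [None])) n d 0 1 1 0,
     out @ encode_edges (token_edges n c (map Some F @ [None])))"
  using assms
  by (induction F arbitrary: c f3 out)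
    (simp_all add: encode_nats_def read_element run_symbol_prog(8))

lemma token_edges_append:
  "token_edges n c (ts @ us) = token_edges n c ts @ token_edges n (path_end n c ts) us"
  "path_end n c (ts @ us) = path_end n (path_end n c ts) us"
  by (induction n c ts rule: token_edges.induct) auto

lemma read_sets:
  assumes "\<forall>F \<in> set Fs. set F \<subseteq> {..<n}"
  shows "read (concat (map encode_nats Fs)) (regs n c n d 0 1 1 0, out) =
    (regs n (path_end n c (tokens Fs)) n d 0 1 1 0, out @ encode_edges (token_edges n c (tokens Fs)))"
  using assms
  by (induction Fs arbitrary: c out)
    (simp_all add: tokens_def read_set token_edges_append del: append_assoc add: append_assoc[symmetric])

lemma read_encode_hitting_set:
  assumes "\<forall>F \<in> set Fs. set F \<subseteq> {..<n}"
  shows "read (encode_hitting_set n Fs k) (start_config n) =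
    (regs n (path_end n (base n) (tokens Fs)) n (n - k) 0 1 1 0,
     encode_edges (token_edges n (base n) (tokens Fs)))"
  using read_header[of n k] read_sets[OF assms, of "base n" "n - k" "[]"]
  by (simp add: encode_hitting_set_def)

subsection \<open>Malformed input\<close>

text \<open>The prefixes of valid inputs by parser state: inside the first number, inside the
  budget, or inside the family, with finished sets \<open>Fs\<close>, a started set \<open>F\<close>
  and \<open>e\<close> tally marks of its next element. In the last state, \<open>f3 = 0\<close>
  makes the prefix itself a valid input.\<close>

definition parsed :: "nat \<Rightarrow> symbol list \<Rightarrow> nat \<Rightarrow> nat \<Rightarrow> nat \<Rightarrow> nat \<Rightarrow> nat \<Rightarrow> bool" where
  "parsed n x m e f1 f2 f3 \<longleftrightarrow>
     f1 = 0 \<and> f2 = 0 \<and> f3 = 0 \<and> e = 0 \<and> m \<le> n \<and> x = replicate (n - m) 0 \<or>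
     f1 = 1 \<and> f2 = 0 \<and> f3 = 0 \<and> e = 0 \<and> m = n \<and> (\<exists>k. x = encode_nat n @ replicate k 0) \<or>
     f1 = 1 \<and> f2 = 1 \<and> e + m = n \<and> (\<exists>k Fs F. x = encode_hitting_set n Fs k @ concat (map encode_nat F) @ replicate e 0
       \<and> (\<forall>F \<in> set Fs. set F \<subseteq> {..<n}) \<and> set F \<subseteq> {..<n} \<and> (f3 = 0 \<longrightarrow> F = [] \<and> e = 0))"

text \<open>Reading never stops at an error, so the register bounds have to hold on all inputs; they
  rest on each symbol moving \<open>c\<close> by at most \<open>2 * n + 1\<close>, and they give the
  running time. The final disjunction gives correctness on malformed input.\<close>

lemma read_invariant:
  assumes "set x \<subseteq> {0, 1, 2}"
  shows "\<exists>c m d e f1 f2 f3 es. read x (start_config n) = (regs n c m d e f1 f2 f3, encode_edges es) \<and>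
    c \<le> base n + length x * (2 * n + 1) \<and> m \<le> n \<and> d \<le> n \<and> e \<le> length x \<and>
    f1 \<le> 1 \<and> f2 \<le> f1 \<and> f3 \<le> f2 \<and> ((0, 0) \<in> set es \<or> parsed n x m e f1 f2 f3)"
  using assms
proof (induction x rule: rev_induct)
  case Nil
  have "parsed n [] n 0 0 0 0" by (simp add: parsed_def)
  moreover have "read [] (start_config n) = (regs n (base n) n n 0 0 0 0, encode_edges [])"
    by (simp add: start_config_def)
  ultimately show ?case by (metis le_add1 le_refl zero_le)
next
  case (snoc a x)
  then obtain c m d e f1 f2 f3 es where
    read: "read x (start_config n) = (regs n c m d e f1 f2 f3, encode_edges es)" and
    bounds: "c \<le> base n + length x * (2 * n + 1)" "m \<le> n" "d \<le> n" "e \<le> length x"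
      "f1 \<le> 1" "f2 \<le> f1" "f3 \<le> f2" and
    or: "(0, 0) \<in> set es \<or> parsed n x m e f1 f2 f3"
    by auto
  note step = run_symbol_prog(1-8)[where out = "encode_edges es"]
  \<comment> \<open>Reduces each transition to a check of one step. A loop stays in the list once
    emitted, so \<open>parsed\<close> has to be maintained only from prefixes that satisfy
    it.\<close>
  have intro: ?case
    if "run (symbol_prog a) (regs n c m d e f1 f2 f3, encode_edges es) =
        (regs n c' m' d' e' f1' f2' f3', encode_edges es @ encode_edges es')"
      and "c' \<le> c + 2 * n + 1" "m' \<le> n" "d' \<le> d" "e' \<le> Suc e" "f1' \<le> 1" "f2' \<le> f1'" "f3' \<le> f2'"
      and "(0, 0) \<in> set es' \<or> (parsed n x m e f1 f2 f3 \<longrightarrow> parsed n (x @ [a]) m' e' f1' f2' f3')"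
    for c' m' d' e' f1' f2' f3' es'
  proof -
    have "read (x @ [a]) (start_config n) = (regs n c' m' d' e' f1' f2' f3', encode_edges (es @ es'))"
      using that(1) read by simp
    moreover have "c' \<le> base n + length (x @ [a]) * (2 * n + 1)"
      using that(2) bounds(1) by simp
    moreover have "d' \<le> n" "e' \<le> length (x @ [a])" using that(4,5) bounds(3,4) by simp_all
    moreover have "(0, 0) \<in> set (es @ es') \<or> parsed n (x @ [a]) m' e' f1' f2' f3'"
      using or that(9) by auto
    ultimately show ?thesis using that(3,6-8) by blast
  qed
  have "a = 0 \<or> a = 1 \<or> a = 2" using snoc.prems by simp
  moreover have "f1 = 0 \<and> f2 = 0 \<and> f3 = 0 \<or> f1 = 1 \<and> f2 = 0 \<and> f3 = 0 \<or> f1 = 1 \<and> f2 = 1"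
    using bounds(5-7) by linarith
  ultimately show ?case
  proof (elim disjE conjE)
    assume 1: "a = 0" "f1 = 0" "f2 = 0" "f3 = 0"
    have p: "parsed n (x @ [0]) (m - 1) e 0 0 0" if "parsed n x m e 0 0 0" "m \<noteq> 0"
    proof -
      have "x @ [0] = replicate (Suc (n - m)) 0" "m \<le> n" "e = 0"
        using that by (auto simp: parsed_def replicate_append_same)
      moreover have "Suc (n - m) = n - (m - 1)" using that(2) \<open>m \<le> n\<close> by simp
      ultimately show ?thesis by (simp add: parsed_def)
    qed
    show ?case
      by (rule intro[of c "m - 1" d e 0 0 0 "if m = 0 then [(0, 0)] else []"])
        (use 1 bounds step(1)[of n c m d e f3] p in auto)
  next
    assume 2: "a = 0" "f1 = 1" "f2 = 0" "f3 = 0"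
    have p: "parsed n (x @ [0]) m e 1 0 0" if "parsed n x m e 1 0 0"
      using that by (auto simp: parsed_def replicate_append_same intro: exI[of _ "Suc _"])
    show ?case
      by (rule intro[of c m "d - 1" e 1 0 0 "[]"])
        (use 2 bounds step(2)[of n c m d e f3] p in auto)
  next
    assume 3: "a = 0" "f1 = 1" "f2 = 1"
    have p: "parsed n (x @ [0]) (m - 1) (e + 1) 1 1 1" if q: "parsed n x m e 1 1 f3" and m: "m \<noteq> 0"
    proof -
      from q obtain k Fs F where
        x: "x = encode_hitting_set n Fs k @ concat (map encode_nat F) @ replicate e 0" and
        F: "\<forall>F \<in> set Fs. set F \<subseteq> {..<n}" "set F \<subseteq> {..<n}" and e: "e + m = n"
        by (auto simp: parsed_def)
      have "x @ [0] = encode_hitting_set n Fs k @ concat (map encode_nat F) @ replicate (e + 1) 0"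
        using x by (simp add: replicate_append_same flip: Suc_eq_plus1)
      moreover have "(e + 1) + (m - 1) = n" using e m by simp
      ultimately show ?thesis unfolding parsed_def using F by (intro disjI2) auto
    qed
    show ?case
      by (rule intro[of c "m - 1" d "e + 1" 1 1 1 "if m = 0 then [(0, 0)] else []"])
        (use 3 bounds step(3)[of n c m d e f3] p in auto)
  next
    assume 4: "a = 1" "f1 = 0" "f2 = 0" "f3 = 0"
    have p: "parsed n (x @ [1]) n e 1 0 0" if "parsed n x 0 e 0 0 0"
      using that by (auto simp: parsed_def encode_nat_def)
    show ?case
      by (rule intro[of c n d e 1 0 0 "if m = 0 then [] else [(0, 0)]"])
        (use 4 bounds step(4)[of n c m d e f3] p in auto)
  next
    assume 5: "a = 1" "f1 = 1" "f2 = 0" "f3 = 0"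
    have p: "parsed n (x @ [1]) m e 1 1 0" if q: "parsed n x m e 1 0 0"
    proof -
      from q obtain k where "x = encode_nat n @ replicate k 0" "m = n" "e = 0"
        by (auto simp: parsed_def)
      then have "x @ [1] = encode_hitting_set n [] k"
        by (simp add: encode_hitting_set_def encode_nat_def)
      with \<open>m = n\<close> \<open>e = 0\<close> show ?thesis
        unfolding parsed_def by (intro disjI2 conjI exI[of _ k] exI[of _ "[]"]) auto
    qed
    show ?case
      by (rule intro[of c m d e 1 1 0 "[]"])
        (use 5 bounds step(5)[of n c m d e f3] p in auto)
  next
    assume 6: "a = 1" "f1 = 1" "f2 = 1"
    have p: "parsed n (x @ [1]) n 0 1 1 1" if q: "parsed n x m e 1 1 f3" and m: "m \<noteq> 0"
    proof -
      from q obtain k Fs F where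
        x: "x = encode_hitting_set n Fs k @ concat (map encode_nat F) @ replicate e 0" and
        F: "\<forall>F \<in> set Fs. set F \<subseteq> {..<n}" "set F \<subseteq> {..<n}" and e: "e + m = n"
        by (auto simp: parsed_def)
      have "x @ [1] = encode_hitting_set n Fs k @ concat (map encode_nat (F @ [e]))"
        using x by (simp add: encode_nat_def)
      moreover have "set (F @ [e]) \<subseteq> {..<n}" using F(2) e m by simp
      ultimately show ?thesis
        unfolding parsed_def using F(1)
        by (intro disjI2 conjI exI[of _ k] exI[of _ Fs] exI[of _ "F @ [e]"]) auto
    qed
    show ?case
      by (rule intro[of "c + 2 * n" n d 0 1 1 1 "(if m = 0 then [(0, 0)] else []) @ element_edges n c e"])
        (use 6 bounds step(6)[of n c m d e f3] p in auto)
  next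
    assume 7: "a = 2" "f1 = 0" "f2 = 0" "f3 = 0"
    with bounds show ?case
      using intro[of c m d e f1 0 0 "[(0, 0)]"] step(7)[of n c m d e f1 f3] by auto
  next
    assume 8: "a = 2" "f1 = 1" "f2 = 0" "f3 = 0"
    with bounds show ?case
      using intro[of c m d e f1 0 0 "[(0, 0)]"] step(7)[of n c m d e f1 f3] by auto
  next
    assume 9: "a = 2" "f1 = 1" "f2 = 1"
    have p: "parsed n (x @ [2]) m e 1 1 0" if q: "parsed n x m e 1 1 f3" and "e = 0"
    proof -
      from q \<open>e = 0\<close> obtain k Fs F where
        x: "x = encode_hitting_set n Fs k @ concat (map encode_nat F)" and
        F: "\<forall>F \<in> set Fs. set F \<subseteq> {..<n}" "set F \<subseteq> {..<n}" and e: "e + m = n"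
        by (auto simp: parsed_def)
      have "x @ [2] = encode_hitting_set n (Fs @ [F]) k"
        using x by (simp add: encode_hitting_set_def encode_nats_def)
      then show ?thesis
        unfolding parsed_def using F e \<open>e = 0\<close>
        by (intro disjI2 conjI exI[of _ k] exI[of _ "Fs @ [F]"] exI[of _ "[]"]) auto
    qed
    show ?case
      by (rule intro[of "c + 1" m d e 1 1 0 "(if e = 0 then [] else [(0, 0)]) @ [(c, 2), (c + 1, 0), (c + 1, 4)]"])
        (use 9 bounds step(8)[of n c m d e f1 f3] p in auto)
  qed
qed

subsection \<open>Correctness and running time\<close>

definition reader :: program where
  "reader = While (Neg (Emp 0)) (Seq
     (Cond (Top 0 0) (compile (symbol_prog 0))
        (Cond (Top 0 1) (compile (symbol_prog 1)) (compile (symbol_prog 2)))) (Pop 0))"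

lemma represents_input [simp]: "represents (s(0 := x)) \<sigma> \<longleftrightarrow> represents s \<sigma>"
  by (simp add: represents_def rep_def)

text \<open>Composing the time polynomial of a symbol once per symbol would not yield a polynomial.
  The bound \<open>T\<close> is therefore assumed uniformly for all prefixes; it will come from the
  global register bounds of \<open>read_invariant\<close>.\<close>

lemma exec_reader:
  assumes "represents s \<sigma>" and "s 0 = x" and "set x \<subseteq> {0, 1, 2}"
    and "\<And>ys a zs s. x = ys @ a # zs \<Longrightarrow> represents s (read ys \<sigma>) \<Longrightarrow>
      \<exists>t s'. exec (compile (symbol_prog a)) s t s' \<and> t \<le> T \<and>
        represents s' (run (symbol_prog a) (read ys \<sigma>)) \<and> s' 0 = s 0"
  shows "\<exists>t s'. exec reader s t s' \<and> t \<le> length x * (T + 4) + 1 \<and> represents s' (read x \<sigma>) \<and> s' 0 = []"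
  using assms
proof (induction x arbitrary: s \<sigma>)
  case Nil
  then show ?case
    using WhileFalse[of "Neg (Emp 0)" s] by (auto simp: reader_def)
next
  case (Cons a x)
  obtain t s' where t: "exec (compile (symbol_prog a)) s t s'" "t \<le> T"
      "represents s' (run (symbol_prog a) \<sigma>)" "s' 0 = s 0"
    using Cons.prems(4)[of "[]" a x s] Cons.prems(1) by auto
  let ?c = "Cond (Top 0 0) (compile (symbol_prog 0))
        (Cond (Top 0 1) (compile (symbol_prog 1)) (compile (symbol_prog 2)))"
  let ?s = "s'(0 := tl (s' 0))"
  have "a = 0 \<or> a = 1 \<or> a = 2" using Cons.prems(3) by simp
  then have "\<exists>u \<le> t + 2. exec ?c s u s'"
  proof (elim disjE)
    assume "a = 0"
    then have "exec ?c s (Suc t) s'" using t(1) Cons.prems(2) by (intro CondTrue) auto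
    then show ?thesis by (intro exI[of _ "Suc t"]) simp
  next
    assume "a = 1"
    then have "exec ?c s (Suc (Suc t)) s'"
      using t(1) Cons.prems(2) by (intro CondFalse[OF _ CondTrue]) auto
    then show ?thesis by (intro exI[of _ "Suc (Suc t)"]) simp
  next
    assume "a = 2"
    then have "exec ?c s (Suc (Suc t)) s'"
      using t(1) Cons.prems(2) by (intro CondFalse) auto
    then show ?thesis by (intro exI[of _ "Suc (Suc t)"]) simp
  qed
  then obtain u where u: "u \<le> t + 2" "exec ?c s u s'" by blast
  have "\<exists>t s''. exec reader ?s t s'' \<and> t \<le> length x * (T + 4) + 1 \<and>
      represents s'' (read x (run (symbol_prog a) \<sigma>)) \<and> s'' 0 = []"
  proof (rule Cons.IH[of ?s])
    show "represents ?s (run (symbol_prog a) \<sigma>)"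
      unfolding represents_input by (rule t(3))
  next
    fix ys b zs and s :: state
    assume "x = ys @ b # zs" "represents s (read ys (run (symbol_prog a) \<sigma>))"
    then show "\<exists>t s'. exec (compile (symbol_prog b)) s t s' \<and> t \<le> T \<and>
        represents s' (run (symbol_prog b) (read ys (run (symbol_prog a) \<sigma>))) \<and> s' 0 = s 0"
      using Cons.prems(4)[of "a # ys" b zs s] by simp
  qed (use t Cons.prems in auto)
  then obtain v s'' where v: "exec reader ?s v s''" "v \<le> length x * (T + 4) + 1"
      "represents s'' (read x (run (symbol_prog a) \<sigma>))" "s'' 0 = []"
    by blast
  have "holds (Neg (Emp 0)) s" using Cons.prems(2) by simp
  from WhileTrue[OF this exec.Seq[OF u(2) exec.Pop] v(1)[unfolded reader_def]]
  have "exec reader s (Suc (u + 1 + v)) s''" by (simp add: reader_def)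
  moreover have "Suc (u + 1 + v) \<le> length (a # x) * (T + 4) + 1"
    using u(1) t(2) v(2) by simp
  ultimately show ?case unfolding read_simps using v(3,4) by blast
qed

text \<open>Moving the reversed output from stack 2 to stack 0 symbol by symbol puts it into the
  right order.\<close>

definition pour :: program where
  "pour = While (Neg (Emp 2)) (Seq
     (Cond (Top 2 0) (Push 0 0) (Cond (Top 2 1) (Push 0 1) (Push 0 2))) (Pop 2))"

lemma exec_pour:
  assumes "set (s 2) \<subseteq> {0, 1, 2}"
  shows "\<exists>t. exec pour s t (s(0 := rev (s 2) @ s 0, 2 := [])) \<and> t \<le> 5 * length (s 2) + 1"
  using assms
proof (induction "s 2" arbitrary: s)
  case Nil
  then have "s(0 := rev (s 2) @ s 0, 2 := []) = s" by auto
  with Nil show ?case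
    using WhileFalse[of "Neg (Emp 2)" s] by (auto simp: pour_def)
next
  case (Cons a x)
  note sx = Cons.hyps(2)[symmetric]
  let ?c = "Cond (Top 2 0) (Push 0 0) (Cond (Top 2 1) (Push 0 1) (Push 0 2))"
  let ?s = "s(0 := a # s 0)"
  let ?s' = "?s(2 := tl (?s 2))"
  have "a = 0 \<or> a = 1 \<or> a = 2" using Cons.prems sx by simp
  then have "\<exists>u \<le> 3. exec ?c s u ?s"
  proof (elim disjE)
    assume "a = 0"
    then have "exec ?c s (Suc 1) ?s" using exec.Push[of 0 0 s] sx by (intro CondTrue) auto
    then show ?thesis by (intro exI[of _ "Suc 1"]) simp
  next
    assume "a = 1"
    then have "exec ?c s (Suc (Suc 1)) ?s"
      using exec.Push[of 0 1 s] sx by (intro CondFalse[OF _ CondTrue]) auto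
    then show ?thesis by (intro exI[of _ "Suc (Suc 1)"]) simp
  next
    assume "a = 2"
    then have "exec ?c s (Suc (Suc 1)) ?s"
      using exec.Push[of 0 2 s] sx by (intro CondFalse) auto
    then show ?thesis by (intro exI[of _ "Suc (Suc 1)"]) simp
  qed
  then obtain u where u: "u \<le> 3" "exec ?c s u ?s" by blast
  have "\<exists>t. exec pour ?s' t (?s'(0 := rev (?s' 2) @ ?s' 0, 2 := [])) \<and> t \<le> 5 * length (?s' 2) + 1"
    by (rule Cons.hyps(1)) (use sx Cons.prems in auto)
  then obtain v where v: "exec pour ?s' v (?s'(0 := rev (?s' 2) @ ?s' 0, 2 := []))"
      "v \<le> 5 * length (?s' 2) + 1" by blast
  have eq: "?s'(0 := rev (?s' 2) @ ?s' 0, 2 := []) = s(0 := rev (s 2) @ s 0, 2 := [])"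
    using sx by (auto simp: fun_eq_iff)
  have "holds (Neg (Emp 2)) s" using sx by simp
  from WhileTrue[OF this exec.Seq[OF u(2) exec.Pop] v(1)[unfolded pour_def eq]]
  have "exec pour s (Suc (u + 1 + v)) (s(0 := rev (s 2) @ s 0, 2 := []))" by (simp only: pour_def)
  moreover have "Suc (u + 1 + v) \<le> 5 * length (s 2) + 1"
    using u(1) v(2) sx by simp
  ultimately show ?case by blast
qed

definition order_expr :: expr where
  "order_expr = Plus (Var 4) (Const 1)"

text \<open>The encoding starts with the number of vertices, which is known only after all sets have
  been read. Since stack 0 grows at its front, this number can be pushed last.\<close>

definition reduction_program :: program where
  "reduction_program = Seq (compile start_prog) (Seq reader (Seq (compile finish_prog)
     (Seq pour (Seq (Push 0 1) (compile_expr order_expr 0 14)))))"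

definition reduction :: "symbol list \<times> nat \<Rightarrow> symbol list \<times> nat" where
  "reduction = (\<lambda>(x, n). case run finish_prog (read x (start_config n)) of
     (\<rho>, out) \<Rightarrow> (encode_nat (\<rho> 4 + 1) @ out, base n))"

definition modulator_list :: "nat \<Rightarrow> nat list" where
  "modulator_list n = concat (map (\<lambda>i. [i, i]) (rev [0..<base n]))"

lemma set_modulator_list: "set (modulator_list n) = {..<base n}"
  by (auto simp: modulator_list_def)

lemma run_finish_prog_encode:
  assumes "read x (start_config n) = (regs n c m d e f1 f2 f3, encode_edges es)"
  defines "es' \<equiv> es @ (if f2 = 0 then [(0, 0)] else []) @ (if f3 = 0 then [] else [(0, 0)]) @ gadget_edges n d"
  shows "reduction (x, n) = (encode_graph (c + 1) es' (modulator_list n), base n)"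
proof -
  have "encode_edges (map (\<lambda>i. (i, i)) is) = concat (map encode_nat (concat (map (\<lambda>i. [i, i]) is)))" for "is"
    by (simp add: encode_edges_def comp_def)
  then show ?thesis
    using run_finish_prog[of n c m d e f1 f2 f3 es] assms(1)
    by (simp add: reduction_def encode_graph_def encode_nats_def es'_def modulator_list_def
        encode_edges_def)
qed

lemma encode_nats_in_lists: "encode_nats ns \<in> lists {0, 1, 2}"
  by (auto simp: encode_nats_def encode_nat_def split: if_splits)

lemma encode_graph_in_lists: "encode_graph n es xs \<in> lists {0, 1, 2}"
  using encode_nats_in_lists by (auto simp: encode_graph_def encode_nat_def)

lemma reduction_in_lists:
  assumes "x \<in> lists {0, 1, 2}"
  shows "fst (reduction (x, n)) \<in> lists {0, 1, 2}"
proof -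
  from assms have "set x \<subseteq> {0, 1, 2}" by auto
  from read_invariant[OF this, of n] obtain c m d e f1 f2 f3 es where
    "read x (start_config n) = (regs n c m d e f1 f2 f3, encode_edges es)" by blast
  from run_finish_prog_encode[OF this] encode_graph_in_lists show ?thesis by simp
qed

lemma poly_time_reduction: "poly_time_computable {0, 1, 2} reduction"
proof -
  from exec_compile[OF wf_progs(1)] obtain p1 where p1: "statement_time start_prog p1" ..
  from exec_compile[OF wf_progs(2)] obtain q where q: "\<And>a. statement_time (symbol_prog a) (q a)" by metis
  from exec_compile[OF wf_progs(3)] obtain p3 where p3: "statement_time finish_prog p3" ..
  have "\<forall>r \<in> vars order_expr. register r \<and> r < 14" by (simp add: order_expr_def)
  from exec_compile_expr[OF this] obtain p5 where p5: "expr_time order_expr 14 p5" ..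
  \<comment> \<open>With \<open>N\<close> the input size, this dominates register 4, at most
    \<open>5 + 2 * N * N + N * (2 * N + 1)\<close>, as well as \<open>N + 1\<close>, which covers
    the other registers.\<close>
  define B :: "nat poly" where "B = [:6, 1:] + [:0, 2:] * [:0, 1:] + [:0, 1:] * [:1, 2:]"
  define p2 where "p2 = [:0, 1:] * (pcompose (q 0 + q 1 + q 2) B + [:4:]) + [:1:]"
  define p3' where "p3' = pcompose p3 B"
  \<comment> \<open>Pouring takes at most five steps per symbol, and the output is no longer than
    the time spent so far.\<close>
  define p4 where "p4 = [:5:] * (p1 + p2 + p3') + [:1:]"
  define p where "p = p1 + p2 + p3' + p4 + [:1:] + pcompose p5 p3'"
  have B: "poly B N = 6 + N + 2 * N * N + N * (2 * N + 1)" for N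
    by (simp add: B_def algebra_simps)
  show ?thesis
    unfolding poly_time_computable_def
  proof (intro exI[of _ reduction_program] exI[of _ p] ballI allI)
    fix x n assume x: "x \<in> lists {0, 1, 2 :: symbol}"
    let ?N = "length x + n"
    have set_x: "set x \<subseteq> {0, 1, 2}" using x by auto
    have bound: "fst (read y (start_config n)) r \<le> poly B ?N" "11 \<le> r \<Longrightarrow> fst (read y (start_config n)) r = 0"
      if y: "set y \<subseteq> {0, 1, 2}" "length y \<le> length x" for y r
    proof -
      from read_invariant[OF y(1), of n] obtain c m d e f1 f2 f3 es where
        read: "read y (start_config n) = (regs n c m d e f1 f2 f3, encode_edges es)" and
        le: "c \<le> base n + length y * (2 * n + 1)" "m \<le> n" "d \<le> n" "e \<le> length y"
          "f1 \<le> 1" "f2 \<le> f1" "f3 \<le> f2" by blast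
      have "2 * n * n \<le> 2 * ?N * ?N" by (intro mult_mono) auto
      moreover have "length y * (2 * n + 1) \<le> ?N * (2 * ?N + 1)"
        using y(2) by (intro mult_mono) auto
      ultimately have c: "c \<le> poly B ?N" using le(1) unfolding B base_def by linarith
      have N: "?N + 1 \<le> poly B ?N" unfolding B by simp
      show "fst (read y (start_config n)) r \<le> poly B ?N"
        unfolding read fst_conv by (rule regs_le) (use c N le y(2) in linarith)+
      show "fst (read y (start_config n)) r = 0" if "11 \<le> r"
        unfolding read fst_conv using that by (rule regs_eq_0)
    qed
    let ?s = "initial_state x n"
    have run_start: "run start_prog (regs n 0 0 0 0 0 0 0, []) = start_config n"
      by (simp add: start_prog_def start_config_def base_expr_def base_def mult.assoc)
    have "represents ?s (regs n 0 0 0 0 0 0 0, [])"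
      by (auto simp: represents_def rep_def initial_state_def regs_def)
    moreover have "fst (regs n 0 0 0 0 0 0 0, [] :: symbol list) r \<le> ?N" for r
      by (auto intro: regs_le)
    ultimately have "runs start_prog ?s (regs n 0 0 0 0 0 0 0, []) (poly p1 ?N)"
      by (intro statement_timeD[OF p1]) (auto simp: regs_eq_0)
    then obtain t1 s1 where t1: "exec (compile start_prog) ?s t1 s1" "t1 \<le> poly p1 ?N"
        "represents s1 (start_config n)" "s1 0 = x"
      unfolding runs_def run_start by (auto simp: initial_state_def)
    define T where "T = poly (q 0 + q 1 + q 2) (poly B ?N)"
    have "\<exists>t s2. exec reader s1 t s2 \<and> t \<le> length x * (T + 4) + 1 \<and>
        represents s2 (read x (start_config n)) \<and> s2 0 = []"
    proof (rule exec_reader[OF t1(3,4) set_x])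
      fix ys a zs and s :: state
      assume xys: "x = ys @ a # zs" and s: "represents s (read ys (start_config n))"
      have ys: "set ys \<subseteq> {0, 1, 2}" "length ys \<le> length x" using set_x xys by auto
      have "runs (symbol_prog a) s (read ys (start_config n)) (poly (q a) (poly B ?N))"
        by (rule statement_timeD[OF q s]) (use bound[OF ys] in auto)
      moreover have "a = 0 \<or> a = 1 \<or> a = 2" using set_x xys by auto
      then have "poly (q a) (poly B ?N) \<le> T" by (auto simp: T_def)
      ultimately show "\<exists>t s'. exec (compile (symbol_prog a)) s t s' \<and> t \<le> T \<and>
          represents s' (run (symbol_prog a) (read ys (start_config n))) \<and> s' 0 = s 0"
        unfolding runs_def using le_trans by blast
    qed
    then obtain t2 s2 where t2: "exec reader s1 t2 s2" "t2 \<le> length x * (T + 4) + 1"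
        "represents s2 (read x (start_config n))" "s2 0 = []" by blast
    have "length x * (T + 4) \<le> ?N * (T + 4)" by (intro mult_le_mono1) simp
    with t2(2) have "t2 \<le> ?N * (T + 4) + 1" by linarith
    then have t2': "t2 \<le> poly p2 ?N" by (simp add: p2_def T_def poly_pcompose)
    obtain \<rho> out where fin: "run finish_prog (read x (start_config n)) = (\<rho>, out)" by fastforce
    have "runs finish_prog s2 (read x (start_config n)) (poly p3' ?N)"
      unfolding p3'_def poly_pcompose by (rule statement_timeD[OF p3 t2(3)]) (use bound[OF set_x] in auto)
    then obtain t3 s3 where t3: "exec (compile finish_prog) s2 t3 s3" "t3 \<le> poly p3' ?N"
        "represents s3 (\<rho>, out)" "s3 0 = []" and
      \<rho>: "\<And>r. \<rho> r \<le> poly p3' ?N" "\<And>r. 11 \<le> r \<Longrightarrow> \<rho> r = 0"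
      unfolding runs_def fin t2(4) by auto
    have red: "reduction (x, n) = (encode_nat (\<rho> 4 + 1) @ out, base n)"
      by (simp add: reduction_def fin)
    have s3: "s3 2 = rev out" "rep s3 \<rho>" using t3(3) by (auto simp: represents_def)
    have "set (s3 2) \<subseteq> {0, 1, 2}"
      using reduction_in_lists[OF x, of n] by (auto simp: red s3)
    from exec_pour[of s3, OF this] t3(4) s3(1) obtain t4 where
      t4: "exec pour s3 t4 (s3(0 := out, 2 := []))" "t4 \<le> 5 * length (s3 2) + 1"
      by auto
    have "length (s3 2) \<le> t1 + t2 + t3"
      using exec_length_le[OF t1(1), of 2] exec_length_le[OF t2(1), of 2] exec_length_le[OF t3(1), of 2]
      by (simp add: initial_state_def)
    then have t4': "t4 \<le> poly p4 ?N"
      using t4(2) t1(2) t2' t3(2) by (simp add: p4_def)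
    let ?s4 = "s3(0 := out, 2 := [])"
    let ?s5 = "?s4(0 := 1 # ?s4 0)"
    let ?s6 = "?s5(0 := replicate (val order_expr \<rho>) 0 @ ?s5 0)"
    have "rep ?s5 \<rho>" using s3(2) by (simp add: rep_def)
    then obtain t6 where t6: "exec (compile_expr order_expr 0 14) ?s5 t6 ?s6" "t6 \<le> poly p5 (poly p3' ?N)"
      using expr_timeD[OF p5, of ?s5 \<rho> "poly p3' ?N" 0] \<rho> by (auto simp: order_expr_def)
    have "exec reduction_program ?s (t1 + (t2 + (t3 + (t4 + (1 + t6))))) ?s6"
      unfolding reduction_program_def
      by (rule exec.Seq[OF t1(1) exec.Seq[OF t2(1) exec.Seq[OF t3(1) exec.Seq[OF t4(1)
          exec.Seq[OF exec.Push t6(1)]]]]])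
    moreover have "t1 + (t2 + (t3 + (t4 + (1 + t6)))) \<le> poly p ?N"
      using t1(2) t2' t3(2) t4' t6(2) by (simp add: p_def poly_pcompose)
    moreover have "?s6 0 = fst (reduction (x, n))"
      by (simp add: red order_expr_def encode_nat_def)
    moreover have "?s6 1 = replicate (snd (reduction (x, n))) 0"
    proof -
      from read_invariant[OF set_x, of n] obtain c m d e f1 f2 f3 es where
        "read x (start_config n) = (regs n c m d e f1 f2 f3, encode_edges es)" by blast
      with run_finish_prog[of n c m d e f1 f2 f3 es] fin have "\<rho> 1 = base n" by auto
      then show ?thesis using s3(2) by (simp add: rep_def red)
    qed
    ultimately show "\<exists>t s. exec reduction_program ?s t s \<and> t \<le> poly p ?N \<and>
        s 0 = fst (reduction (x, n)) \<and> s 1 = replicate (snd (reduction (x, n))) 0"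
      by blast
  qed
qed

text \<open>Injectivity of the encodings lets membership be read off the encoded parts. A word that
  encodes no instance for this parameter is mapped to a graph with a loop at 0, so both memberships
  fail.\<close>

lemma reduction_correct:
  assumes "x \<in> lists {0, 1, 2}"
  shows "(x, n) \<in> snd HittingSet_n \<longleftrightarrow> reduction (x, n) \<in> snd StableCutset_mod_lin_forest"
proof -
  have in_sc: "(encode_graph N es xs, card (set xs)) \<in> snd StableCutset_mod_lin_forest \<longleftrightarrow>
      simple_graph (graph_of N es) \<and> set xs \<subseteq> {..<N} \<and>
      linear_forest (delete_vertices (graph_of N es) (set xs)) \<and> (\<exists>S. stable_cutset (graph_of N es) S)"
    for N es xs
    by (auto simp: StableCutset_mod_lin_forest_def encode_graph_inject)
  show ?thesis
  proof (cases "\<exists>Fs k. x = encode_hitting_set n Fs k \<and> (\<forall>F \<in> set Fs. set F \<subseteq> {..<n})")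
    case True
    then obtain Fs k where x: "x = encode_hitting_set n Fs k" and Fs: "\<forall>F \<in> set Fs. set F \<subseteq> {..<n}"
      by blast
    let ?ts = "tokens Fs"
    have ts: "e < n" if "Some e \<in> set ?ts" for e
      using that Fs by (auto simp: tokens_def split: if_splits)
    have d: "n - k \<le> n" by simp
    have red: "reduction (x, n) = (encode_graph (hs_order n ?ts) (hs_edges n (n - k) ?ts) (modulator_list n),
        card (set (modulator_list n)))"
      using run_finish_prog_encode[OF read_encode_hitting_set[OF Fs, of k, folded x]]
      by (simp add: hs_order_def hs_edges_def set_modulator_list)
    have le: "base n \<le> hs_order n ?ts" using path_end_ge[of "base n" n ?ts] by (simp add: hs_order_def)
    have "reduction (x, n) \<in> snd StableCutset_mod_lin_forest \<longleftrightarrow>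
        (\<exists>S. stable_cutset (graph_of (hs_order n ?ts) (hs_edges n (n - k) ?ts)) S)"
      unfolding red in_sc unfolding set_modulator_list
      using simple_graph_hs[of ?ts, OF ts d] linear_forest_hs[of ?ts, OF ts d] le by simp
    also have "\<dots> \<longleftrightarrow> (\<exists>H \<subseteq> {..<n}. card H \<le> n - (n - k) \<and> all_hit (\<lambda>e. e \<in> H) False ?ts)"
      by (rule stable_cutset_hs[OF ts d])
    also have "\<dots> \<longleftrightarrow> (\<exists>H. hitting_set {..<n} (set ` set Fs) H \<and> card H \<le> k)"
    proof -
      \<comment> \<open>\<open>n - (n - k)\<close> is the smaller of \<open>n\<close> and
        \<open>k\<close>, and a subset of \<open>{..<n}\<close> has at most \<open>n\<close>
        elements.\<close>
      have "card H \<le> n - (n - k) \<longleftrightarrow> card H \<le> k" if "H \<subseteq> {..<n}" for H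
        using card_mono[OF finite_lessThan that] by auto
      moreover have "hitting_set {..<n} (set ` set Fs) H \<longleftrightarrow> H \<subseteq> {..<n} \<and> all_hit (\<lambda>e. e \<in> H) False ?ts" for H
        unfolding hitting_set_def all_hit_tokens ball_simps by blast
      ultimately show ?thesis by blast
    qed
    also have "\<dots> \<longleftrightarrow> (x, n) \<in> snd HittingSet_n"
      using Fs by (auto simp: HittingSet_n_def x encode_hitting_set_inject)
    finally show ?thesis by blast
  next
    case False
    then have "(x, n) \<notin> snd HittingSet_n" by (auto simp: HittingSet_n_def)
    moreover have "reduction (x, n) \<notin> snd StableCutset_mod_lin_forest"
    proof -
      from assms have "set x \<subseteq> {0, 1, 2}" by auto
      from read_invariant[OF this, of n] obtain c m d e f1 f2 f3 es where
        read: "read x (start_config n) = (regs n c m d e f1 f2 f3, encode_edges es)" and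
        or: "(0, 0) \<in> set es \<or> parsed n x m e f1 f2 f3" by blast
      define es' where "es' = es @ (if f2 = 0 then [(0, 0)] else []) @
        (if f3 = 0 then [] else [(0, 0)]) @ gadget_edges n d"
      \<comment> \<open>Without a loop from the final tests the header is complete and no set is
        open, so a parsed prefix would be a valid instance.\<close>
      have "\<not> (parsed n x m e f1 f2 f3 \<and> f2 \<noteq> 0 \<and> f3 = 0)"
      proof
        assume "parsed n x m e f1 f2 f3 \<and> f2 \<noteq> 0 \<and> f3 = 0"
        then obtain k Fs F where
          "x = encode_hitting_set n Fs k @ concat (map encode_nat F) @ replicate e 0"
          "\<forall>F \<in> set Fs. set F \<subseteq> {..<n}" "F = []" "e = 0"
          by (auto simp: parsed_def)
        then have "x = encode_hitting_set n Fs k" by simp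
        with False \<open>\<forall>F \<in> set Fs. set F \<subseteq> {..<n}\<close> show False by blast
      qed
      with or have "(0, 0) \<in> set es'" by (auto simp: es'_def)
      then have "\<not> simple_graph (graph_of (c + 1) es')" by (auto simp: simple_graph_of)
      then show ?thesis
        using run_finish_prog_encode[OF read] in_sc[of "c + 1" es' "modulator_list n"]
        by (simp add: es'_def set_modulator_list)
    qed
    ultimately show ?thesis by blast
  qed
qed

lemma hitting_set_ppt_stable_cutset: "HittingSet_n \<le>\<^sub>p\<^sub>p\<^sub>t StableCutset_mod_lin_forest"
proof -
  obtain L L' where L: "HittingSet_n = ({0, 1, 2}, L)" "StableCutset_mod_lin_forest = ({0, 1, 2}, L')"
    by (simp add: HittingSet_n_def StableCutset_mod_lin_forest_def)
  have "snd (reduction (x, n)) = poly [:5, 0, 2:] n" for x n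
    by (simp add: reduction_def base_def split: prod.split)
  then show ?thesis
    unfolding L has_ppt_def split_conv
    using poly_time_reduction reduction_in_lists reduction_correct[unfolded L snd_conv]
    by (intro exI[of _ reduction] conjI exI[of _ "[:5, 0, 2:]"] ballI allI) auto
qed

lemma parameterized_problem_stable_cutset: "parameterized_problem StableCutset_mod_lin_forest"
  unfolding parameterized_problem_def StableCutset_mod_lin_forest_def
  using encode_graph_in_lists by (fastforce simp del: in_lists_conv_set)

theorem theorem7: "ppt_hard MK2 StableCutset_mod_lin_forest"
  using parameterized_problem_stable_cutset has_ppt_trans[OF _ hitting_set_ppt_stable_cutset]
  by (auto simp: ppt_hard_def MK2_def)

end
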